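(* Let $n\ge 3$. The fundamental group of the space $\mathcal{D}^{3,n}$ of non-planar Desargues configurations in $\mathbb{C}\mathrm{P}^n$ is $$\pi_1(\mathcal{D}^{3,n})\cong\begin{cases}\mathbb{Z}_4 & \text{if } n=3,\\ 1 & \text{if } n\geq 4.\end{cases}$$
   Context: For six points $A_1,B_1,A_2,B_2,A_3,B_3\in\mathbb{C}\mathrm{P}^n$ with $A_i\neq B_i$, let $d_i$ denote the projective line through $A_i$ and $B_i$. For $n\ge 3$, $\mathcal{D}^{3,n}$ is the set of 6-tuples $(A_1,B_1,A_2,B_2,A_3,B_3)$ of pairwise distinct points of $\mathbb{C}\mathrm{P}^n$ such that: the six points span a projective subspace of dimension $3$; $d_1\cap d_2\cap d_3$ is a single point; and $A_i,B_i\in d_i\setminus(d_1\cap d_2\cap d_3)$ for $i=1,2,3$. It has the subspace topology from $(\mathbb{C}\mathrm{P}^n)^6$. Here $\mathbb{Z}_4$ is the cyclic group of order $4$ and $1$ the trivial group. *)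

theory Defs
  imports "HOL-Analysis.Analysis" "HOL-Algebra.Elementary_Groups"
begin

section \<open>Complex projective space\<close>

text \<open>
  The points of the projective space of \<open>complex ^ 'n\<close> are its one-dimensional complex linear
  subspaces, so the projective dimension is \<open>CARD('n) - 1\<close>. The operations \<open>vec.subspace\<close>,
  \<open>vec.span\<close> and \<open>vec.dim\<close> refer to the complex scalar multiplication \<open>(*s)\<close>, whereas the unqualified
  \<open>subspace\<close>, \<open>span\<close> and \<open>dim\<close> would be real-linear.
\<close>

lemma dim_span_singleton:
  assumes "v \<noteq> (0 :: complex ^ 'n)"
  shows "vec.dim (vec.span {v}) = 1"
proof -
  have "vec.independent {v}"
    using assms by (simp add: vec.dependent_single)
  from vec.dim_span_eq_card_independent[OF this] show ?thesis
    by simp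
qed

typedef ('n :: finite) cproj = "{L :: (complex ^ 'n) set. vec.subspace L \<and> vec.dim L = 1}"
  morphisms line_of Abs_cproj
proof -
  have "(axis undefined 1 :: complex ^ 'n) \<noteq> 0"
    by (simp add: axis_eq_0_iff)
  from dim_span_singleton[OF this] show ?thesis
    by (intro exI[of _ "vec.span {axis undefined 1}"]) (simp add: vec.subspace_span)
qed

definition proj_point :: "complex ^ 'n \<Rightarrow> 'n::finite cproj" where
  "proj_point v = Abs_cproj (vec.span {v})"

text \<open>
  The topology is the quotient topology along \<open>proj_point\<close> on the nonzero vectors; these form an
  open set, so openness in the subspace of nonzero vectors is openness in \<open>complex ^ 'n\<close>.
\<close>

instantiation cproj :: (finite) topological_space
begin

definition open_cproj :: "'a cproj set \<Rightarrow> bool" where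
  "open_cproj U \<longleftrightarrow> open {v :: complex ^ 'a. v \<noteq> 0 \<and> proj_point v \<in> U}"

instance
proof
  have "{v :: complex ^ 'a. v \<noteq> 0 \<and> proj_point v \<in> UNIV} = - {0}"
    by auto
  then show "open (UNIV :: 'a cproj set)"
    unfolding open_cproj_def by (metis open_delete open_UNIV Compl_eq_Diff_UNIV)
next
  fix S T :: "'a cproj set"
  assume "open S" "open T"
  then have "open ({v :: complex ^ 'a. v \<noteq> 0 \<and> proj_point v \<in> S} \<inter> {v. v \<noteq> 0 \<and> proj_point v \<in> T})"
    unfolding open_cproj_def by (rule open_Int)
  also have "{v :: complex ^ 'a. v \<noteq> 0 \<and> proj_point v \<in> S} \<inter> {v. v \<noteq> 0 \<and> proj_point v \<in> T}
      = {v. v \<noteq> 0 \<and> proj_point v \<in> S \<inter> T}"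
    by auto
  finally show "open (S \<inter> T)"
    by (simp add: open_cproj_def)
next
  fix K :: "'a cproj set set"
  assume "\<forall>S\<in>K. open S"
  then have "open (\<Union>S\<in>K. {v :: complex ^ 'a. v \<noteq> 0 \<and> proj_point v \<in> S})"
    unfolding open_cproj_def by blast
  also have "(\<Union>S\<in>K. {v :: complex ^ 'a. v \<noteq> 0 \<and> proj_point v \<in> S})
      = {v. v \<noteq> 0 \<and> proj_point v \<in> \<Union>K}"
    by auto
  finally show "open (\<Union>K)"
    by (simp add: open_cproj_def)
qed

end

definition proj_subspace :: "nat \<Rightarrow> 'n::finite cproj set \<Rightarrow> bool" where
  "proj_subspace k X \<longleftrightarrow>
     (\<exists>W :: (complex ^ 'n) set. vec.subspace W \<and> vec.dim W = k + 1 \<and> X = {P. line_of P \<subseteq> W})"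

definition proj_span :: "'n::finite cproj set \<Rightarrow> 'n cproj set" where
  "proj_span S = {P. line_of P \<subseteq> vec.span (\<Union>Q\<in>S. line_of Q)}"

abbreviation proj_line :: "'n::finite cproj \<Rightarrow> 'n cproj \<Rightarrow> 'n cproj set" where
  "proj_line A B \<equiv> proj_span {A, B}"


section \<open>Non-planar Desargues configurations\<close>

type_synonym 'n six_points =
  "'n cproj \<times> 'n cproj \<times> 'n cproj \<times> 'n cproj \<times> 'n cproj \<times> 'n cproj"

definition nonplanar_desargues :: "'n::finite six_points set" where
  "nonplanar_desargues =
     {(A1, B1, A2, B2, A3, B3).
        distinct [A1, B1, A2, B2, A3, B3] \<and>
        proj_subspace 3 (proj_span {A1, B1, A2, B2, A3, B3}) \<and>
        (\<exists>I. proj_line A1 B1 \<inter> proj_line A2 B2 \<inter> proj_line A3 B3 = {I}) \<and>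
        (let J = proj_line A1 B1 \<inter> proj_line A2 B2 \<inter> proj_line A3 B3 in
           {A1, B1} \<subseteq> proj_line A1 B1 - J \<and>
           {A2, B2} \<subseteq> proj_line A2 B2 - J \<and>
           {A3, B3} \<subseteq> proj_line A3 B3 - J)}"


section \<open>The fundamental group\<close>

definition loops :: "'a::topological_space set \<Rightarrow> 'a \<Rightarrow> (real \<Rightarrow> 'a) set" where
  "loops X x = {p. path p \<and> path_image p \<subseteq> X \<and> pathstart p = x \<and> pathfinish p = x}"

text \<open>
  Paths are total functions on \<open>real\<close> of which only the restriction to \<open>{0..1}\<close> matters, and
  \<open>homotopic_paths\<close> identifies paths with the same restriction. The set \<open>X\<close> carries the subspace
  topology, since homotopies are maps into \<open>top_of_set X\<close>.
\<close>

definition loop_class :: "'a::topological_space set \<Rightarrow> (real \<Rightarrow> 'a) \<Rightarrow> (real \<Rightarrow> 'a) set" where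
  "loop_class X p = {q. homotopic_paths X p q}"

definition fundamental_group :: "'a::topological_space set \<Rightarrow> 'a \<Rightarrow> (real \<Rightarrow> 'a) set monoid" where
  "fundamental_group X x =
     \<lparr>carrier = loop_class X ` loops X x,
      monoid.mult = (\<lambda>P Q. \<Union>p\<in>P. \<Union>q\<in>Q. loop_class X (p +++ q)),
      one = loop_class X (\<lambda>_. x)\<rparr>"

lemma loop_class_cong:
  assumes "homotopic_paths X p q"
  shows "loop_class X p = loop_class X q"
proof (rule Set.set_eqI)
  fix r
  show "r \<in> loop_class X p \<longleftrightarrow> r \<in> loop_class X q"
    using homotopic_paths_trans[OF assms, of r]
      homotopic_paths_trans[OF homotopic_paths_sym[OF assms], of r]
    unfolding loop_class_def mem_Collect_eq by blast
qed

lemma mult_loop_class: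
  assumes "p \<in> loops X x" "q \<in> loops X x"
  shows "loop_class X p \<otimes>\<^bsub>fundamental_group X x\<^esub> loop_class X q = loop_class X (p +++ q)"
proof -
  have "loop_class X (p' +++ q') = loop_class X (p +++ q)"
    if "p' \<in> loop_class X p" "q' \<in> loop_class X q" for p' q'
  proof (rule loop_class_cong[symmetric], rule homotopic_paths_join)
    show "homotopic_paths X p p'" "homotopic_paths X q q'"
      using that by (simp_all add: loop_class_def)
    show "pathfinish p = pathstart q"
      using assms by (simp add: loops_def)
  qed
  moreover have "p \<in> loop_class X p" "q \<in> loop_class X q"
    using assms by (simp_all add: loops_def loop_class_def)
  ultimately show ?thesis
    unfolding fundamental_group_def monoid.simps by blast
qed

end

theory Submission
  imports Defs
begin

text \<open>
  A non-planar Desargues configuration is a \<open>4\<close>-frame up to a common scalar. If the lines \<open>d\<^sub>i\<close> meet in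
  \<open>[v]\<close>, then \<open>A\<^sub>i = [e\<^sub>i]\<close> and \<open>B\<^sub>i = [e\<^sub>i + v]\<close> for suitable multiples \<open>e\<^sub>i\<close> of representatives of \<open>A\<^sub>i\<close>;
  the six points span a \<open>3\<close>-space exactly when \<open>v, e\<^sub>1, e\<^sub>2, e\<^sub>3\<close> are linearly independent, and only the
  common factor of the four vectors is lost. So the space of configurations is the space of
  \<open>4\<close>-frames in \<open>\<complex>\<^sup>n\<^sup>+\<^sup>1\<close> modulo \<open>\<complex>\<^sup>*\<close>. The map is \<open>desargues\<close>; its image and its fibres are given by
  \<open>desargues_nonplanar\<close>, \<open>nonplanar_desarguesE\<close> and \<open>desargues_eq_iff\<close>.

  Frames of fewer than \<open>m\<close> vectors in \<open>\<complex>\<^sup>m\<close> form a simply connected space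
  (\<open>simply_connected_indep_rows\<close>): dependent tuples have complex codimension at least two, so the
  straight cone over a smooth loop of frames from a generic apex avoids them.

  If \<open>n \<ge> 4\<close>, this applies to the \<open>4\<close>-frames themselves. A loop of configurations lifts to a path of
  frames (\<open>desargues_path_lift\<close>) whose ends differ by a scalar. It is homotopic to a path inside one
  \<open>\<complex>\<^sup>*\<close>-orbit, which the projection collapses to a point.

  If \<open>n = 3\<close>, the frames of determinant one are \<open>SL\<^sub>4(\<complex>)\<close>. This is a retract of the space of
  \<open>4\<times>4\<close> matrices in which three chosen rows are independent, hence simply connected
  (\<open>simply_connected_det_1\<close>). It maps onto the space of configurations, which is \<open>PGL\<^sub>4(\<complex>)\<close>, and two
  of its elements have the same image if and only if they differ by a fourth root of unity. Hence
  loops correspond to the four possible end points of their lifts. To compare end points of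
  lifts of homotopic loops, the configuration space is mapped into a normed space: the products
  \<open>x\<^sub>i\<^sub>j\<^sup>3 x\<^sub>k\<^sub>l\<close> of matrix entries are invariant under fourth roots of unity and separate their
  orbits, so \<open>quartic\<close> is a fourfold covering of its image (\<open>covering_space_quartic\<close>) which factors
  through a continuous injection \<open>quartic_of\<close> of the configuration space. Monodromy of this covering
  gives \<open>\<int>\<^sub>4\<close>.
\<close>

section \<open>Linearly independent rows\<close>

definition indep_rows :: "'k set \<Rightarrow> complex ^ 'n ^ 'k \<Rightarrow> bool" where
  "indep_rows K x \<longleftrightarrow> (\<forall>c. (\<Sum>i\<in>K. c i *s x $ i) = 0 \<longrightarrow> (\<forall>i\<in>K. c i = 0))"

lemma not_indep_rows_iff:
  fixes z :: "complex ^ 'n ^ 'k"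
  shows "\<not> indep_rows K z \<longleftrightarrow> (\<exists>i\<in>K. \<exists>c. z $ i = (\<Sum>j\<in>K - {i}. c j *s z $ j))"
proof
  assume "\<not> indep_rows K z"
  then obtain c i where c: "(\<Sum>i\<in>K. c i *s z $ i) = 0" and i: "i \<in> K" "c i \<noteq> 0"
    by (auto simp: indep_rows_def)
  have "c i *s z $ i = - (\<Sum>j\<in>K - {i}. c j *s z $ j)"
    using c i by (simp add: sum.remove[of K i] eq_neg_iff_add_eq_0)
  then have "z $ i = inverse (c i) *s - (\<Sum>j\<in>K - {i}. c j *s z $ j)"
    using i by (metis vector_smult_assoc left_inverse vector_smult_lid)
  also have "\<dots> = (\<Sum>j\<in>K - {i}. (- inverse (c i) * c j) *s z $ j)"
    by (simp add: vec.scale_sum_right vector_smult_assoc sum_negf vec_eq_iff sum_distrib_left mult_ac)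
  finally show "\<exists>i\<in>K. \<exists>c. z $ i = (\<Sum>j\<in>K - {i}. c j *s z $ j)"
    using i(1) by (intro bexI[of _ i] exI[of _ "\<lambda>j. - inverse (c i) * c j"]) auto
next
  assume "\<exists>i\<in>K. \<exists>c. z $ i = (\<Sum>j\<in>K - {i}. c j *s z $ j)"
  then obtain i c where i: "i \<in> K" and z: "z $ i = (\<Sum>j\<in>K - {i}. c j *s z $ j)"
    by blast
  let ?d = "c(i := -1)"
  have "(\<Sum>j\<in>K. ?d j *s z $ j) = - z $ i + (\<Sum>j\<in>K - {i}. ?d j *s z $ j)"
    using i by (simp add: sum.remove[of K i] vec_eq_iff)
  also have "(\<Sum>j\<in>K - {i}. ?d j *s z $ j) = (\<Sum>j\<in>K - {i}. c j *s z $ j)"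
    by (intro sum.cong) auto
  finally have "(\<Sum>j\<in>K. ?d j *s z $ j) = 0" by (simp flip: z)
  moreover have "?d i \<noteq> 0" by simp
  ultimately show "\<not> indep_rows K z" using i unfolding indep_rows_def by blast
qed

lemma indep_rows_mono: "indep_rows K x \<Longrightarrow> J \<subseteq> K \<Longrightarrow> indep_rows J x"
  unfolding indep_rows_def
proof safe
  fix c i
  assume *: "\<forall>c. (\<Sum>i\<in>K. c i *s x $ i) = 0 \<longrightarrow> (\<forall>i\<in>K. c i = 0)" and J: "J \<subseteq> K"
    and c: "(\<Sum>i\<in>J. c i *s x $ i) = 0" and i: "i \<in> J"
  have "(\<Sum>i\<in>K. (if i \<in> J then c i else 0) *s x $ i) = (\<Sum>i\<in>J. c i *s x $ i)"
    using J by (intro sum.mono_neutral_cong_right) auto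
  with c have "\<forall>i\<in>K. (if i \<in> J then c i else 0) = 0"
    by (intro *[rule_format, of "\<lambda>i. if i \<in> J then c i else 0"] ballI) simp_all
  then show "c i = 0" using i J by (auto split: if_splits)
qed

lemma indep_rows_iff_det:
  fixes x :: "complex ^ 'n ^ 'n"
  shows "indep_rows UNIV x \<longleftrightarrow> det x \<noteq> 0"
proof -
  have "row i x = x $ i" for i by (simp add: row_def)
  then show ?thesis
    using matrix_right_invertible_independent_rows[of x] invertible_right_inverse[of x]
    by (simp add: indep_rows_def invertible_det_nz)
qed

lemma indep_rows_iff_dim:
  fixes x :: "complex ^ 'n ^ 'k"
  shows "indep_rows UNIV x \<longleftrightarrow> vec.dim (range (($) x)) = CARD('k)"
proof
  assume ind: "indep_rows UNIV x"
  have inj: "inj (($) x)"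
  proof (rule injI, rule ccontr)
    fix i j assume ij: "x $ i = x $ j" "i \<noteq> j"
    have "x $ i = (\<Sum>l\<in>UNIV - {i}. (if l = j then 1 else 0) *s x $ l)"
      using ij by (simp add: if_distrib[of "\<lambda>a. a *s _"] cong: if_cong)
    then have "\<not> indep_rows UNIV x"
      unfolding not_indep_rows_iff by (intro bexI[of _ i] exI[of _ "\<lambda>l. if l = j then 1 else 0"]) auto
    then show False using ind by contradiction
  qed
  have "vec.independent (range (($) x))"
  proof
    assume "vec.dependent (range (($) x))"
    then obtain u where u: "\<exists>v\<in>range (($) x). u v \<noteq> 0" "(\<Sum>v\<in>range (($) x). u v *s v) = 0"
      by (subst (asm) vec.dependent_finite) auto
    have "(\<Sum>i\<in>UNIV. u (x $ i) *s x $ i) = 0"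
      using u(2) by (simp add: sum.reindex[OF inj])
    then have "\<forall>i\<in>UNIV. u (x $ i) = 0"
      using ind[unfolded indep_rows_def, rule_format, of "\<lambda>i. u (x $ i)"] by blast
    then show False using u(1) by auto
  qed
  then show "vec.dim (range (($) x)) = CARD('k)"
    by (simp add: vec.dim_eq_card_independent card_image inj)
next
  assume dim: "vec.dim (range (($) x)) = CARD('k)"
  show "indep_rows UNIV x"
  proof (rule ccontr)
    assume "\<not> indep_rows UNIV x"
    then obtain i c where i: "x $ i = (\<Sum>j\<in>UNIV - {i}. c j *s x $ j)"
      by (auto simp: not_indep_rows_iff)
    let ?R = "($) x ` (UNIV - {i})"
    have "x $ i \<in> vec.span ?R"
      unfolding i by (intro vec.span_sum vec.span_scale vec.span_base) auto
    then have "x $ j \<in> vec.span ?R" for j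
      by (cases "j = i") (auto intro: vec.span_base)
    then have "vec.dim (range (($) x)) \<le> card ?R"
      by (intro vec.dim_le_card) auto
    also have "\<dots> \<le> card (UNIV - {i})" by (rule card_image_le) simp
    also have "\<dots> < CARD('k)" by (intro psubset_card_mono) auto
    finally show False using dim by simp
  qed
qed

section \<open>Gram determinants\<close>

definition hermitian :: "complex ^ 'n \<Rightarrow> complex ^ 'n \<Rightarrow> complex" where
  "hermitian u v = (\<Sum>l\<in>UNIV. cnj (u $ l) * v $ l)"

text \<open>
  The Gram matrix of the rows in \<open>K\<close>, filled up with the identity so that its format depends only on
  the type \<open>'k\<close> and its determinant is the Gram determinant of the selected rows.
\<close>

definition gram :: "'k set \<Rightarrow> complex ^ 'n ^ 'k \<Rightarrow> complex ^ 'k ^ 'k" where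
  "gram K x = (\<chi> i j. if i \<in> K \<and> j \<in> K then hermitian (x $ i) (x $ j) else if i = j then 1 else 0)"

lemma hermitian_sum_right: "hermitian u (\<Sum>j\<in>J. c j *s v j) = (\<Sum>j\<in>J. hermitian u (v j) * c j)"
proof -
  have "hermitian u (\<Sum>j\<in>J. c j *s v j) = (\<Sum>l\<in>UNIV. \<Sum>j\<in>J. cnj (u $ l) * v j $ l * c j)"
    by (simp add: hermitian_def sum_distrib_left mult_ac)
  also have "\<dots> = (\<Sum>j\<in>J. \<Sum>l\<in>UNIV. cnj (u $ l) * v j $ l * c j)"
    by (rule sum.swap)
  finally show ?thesis by (simp add: hermitian_def sum_distrib_right)
qed

lemma hermitian_sum_left: "hermitian (\<Sum>j\<in>J. c j *s v j) u = (\<Sum>j\<in>J. cnj (c j) * hermitian (v j) u)"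
proof -
  have "hermitian (\<Sum>j\<in>J. c j *s v j) u = (\<Sum>l\<in>UNIV. \<Sum>j\<in>J. cnj (c j) * (cnj (v j $ l) * u $ l))"
    by (simp add: hermitian_def sum_distrib_right sum_distrib_left mult_ac)
  also have "\<dots> = (\<Sum>j\<in>J. \<Sum>l\<in>UNIV. cnj (c j) * (cnj (v j $ l) * u $ l))"
    by (rule sum.swap)
  finally show ?thesis by (simp add: hermitian_def sum_distrib_left)
qed

lemma hermitian_self_eq_0: "hermitian u u = 0 \<longleftrightarrow> u = 0"
proof
  assume "hermitian u u = 0"
  moreover have "hermitian u u = of_real (\<Sum>l\<in>UNIV. (cmod (u $ l))\<^sup>2)"
    unfolding hermitian_def of_real_sum
    by (intro sum.cong refl) (metis complex_norm_square mult.commute)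
  ultimately have "(\<Sum>l\<in>UNIV. (cmod (u $ l))\<^sup>2) = 0"
    by (metis of_real_eq_0_iff)
  then show "u = 0"
    by (simp add: sum_nonneg_eq_0_iff vec_eq_iff)
qed (simp add: hermitian_def)

text \<open>
  If \<open>c\<close> is in the kernel of the Gram matrix, then \<open>u = \<Sum>\<^sub>j c\<^sub>j x\<^sub>j\<close> is orthogonal to every selected row
  and therefore to itself.
\<close>

lemma det_gram_nonzero_iff: "det (gram K x) \<noteq> 0 \<longleftrightarrow> indep_rows K x"
proof -
  have G: "(gram K x *v c) $ i =
      (if i \<in> K then hermitian (x $ i) (\<Sum>j\<in>K. c $ j *s x $ j) else c $ i)" for c i
  proof -
    have "(gram K x *v c) $ i = (\<Sum>j\<in>UNIV. gram K x $ i $ j * c $ j)"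
      by (simp add: matrix_vector_mult_def)
    also have "\<dots> = (\<Sum>j\<in>UNIV. if i \<in> K then (if j \<in> K then hermitian (x $ i) (x $ j) * c $ j else 0)
        else (if j = i then c $ i else 0))"
      by (intro sum.cong refl) (auto simp: gram_def)
    finally show ?thesis
      by (simp add: hermitian_sum_right sum.If_cases)
  qed
  have "det (gram K x) \<noteq> 0 \<longleftrightarrow> (\<forall>c. gram K x *v c = 0 \<longrightarrow> c = 0)"
    by (simp flip: invertible_det_nz add: invertible_left_inverse matrix_left_invertible_ker)
  also have "\<dots> \<longleftrightarrow> indep_rows K x"
  proof safe
    assume *: "\<forall>c. gram K x *v c = 0 \<longrightarrow> c = 0"
    show "indep_rows K x"
      unfolding indep_rows_def
    proof safe
      fix c i assume c: "(\<Sum>i\<in>K. c i *s x $ i) = 0" and i: "i \<in> K"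
      define d where "d = (\<chi> j. if j \<in> K then c j else 0)"
      have "(\<Sum>j\<in>K. d $ j *s x $ j) = 0"
        using c by (simp add: d_def cong: sum.cong)
      moreover have "(gram K x *v d) $ j = 0" if "j \<notin> K" for j
        using that by (simp add: G) (simp add: d_def)
      ultimately have "gram K x *v d = 0"
        by (auto simp: vec_eq_iff[of "gram K x *v d"] G hermitian_def)
      then show "c i = 0"
        using * i by (metis (mono_tags, lifting) d_def vec_lambda_beta zero_index)
    qed
  next
    fix c assume ind: "indep_rows K x" and 0: "gram K x *v c = 0"
    define u where "u = (\<Sum>j\<in>K. c $ j *s x $ j)"
    have i: "hermitian (x $ i) u = 0" if "i \<in> K" for i
      using G[of c i] 0 that by (simp add: u_def)
    have "hermitian u u = (\<Sum>j\<in>K. cnj (c $ j) * hermitian (x $ j) u)"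
      by (subst (1) u_def) (rule hermitian_sum_left)
    also have "\<dots> = 0" using i by simp
    finally have "u = 0" by (simp add: hermitian_self_eq_0)
    then have "\<forall>j\<in>K. c $ j = 0"
      using ind by (simp add: indep_rows_def u_def)
    moreover have "c $ j = 0" if "j \<notin> K" for j
      using G[of c j] 0 that by simp
    ultimately show "c = 0" by (auto simp: vec_eq_iff)
  qed
  finally show ?thesis .
qed

lemma continuous_on_det:
  fixes A :: "'a::topological_space \<Rightarrow> complex ^ 'k ^ 'k"
  assumes "\<And>i j. continuous_on S (\<lambda>x. A x $ i $ j)"
  shows "continuous_on S (\<lambda>x. det (A x))"
  unfolding det_def by (intro continuous_intros assms)

lemma continuous_on_cdot:
  assumes "continuous_on S f" "continuous_on S g"
  shows "continuous_on S (\<lambda>x. hermitian (f x) (g x))"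
  unfolding hermitian_def by (intro continuous_intros assms)

lemma continuous_on_det_gram:
  assumes "continuous_on S Y"
  shows "continuous_on S (\<lambda>x. det (gram K (Y x)))"
  unfolding gram_def
  apply (rule continuous_on_det)
  subgoal for i j
    by (cases "i \<in> K \<and> j \<in> K") (auto intro!: continuous_intros continuous_on_cdot assms)
  done

lemma open_indep_rows: "open {x. indep_rows K x}"
proof -
  have "open {x. det (gram K x) \<noteq> 0}"
    by (intro open_Collect_neq continuous_on_det_gram continuous_intros)
  then show ?thesis by (simp add: det_gram_nonzero_iff)
qed

text \<open>
  The coefficients solve the linear system with the Gram matrix, so Cramer's rule writes them as
  continuous functions. The frame may span a proper subspace that varies with the parameter.
\<close>

lemma continuous_on_coefficients:
  fixes Y :: "'a::topological_space \<Rightarrow> complex ^ 'n ^ 'k" and c :: "'a \<Rightarrow> complex ^ 'k"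
  assumes Y: "continuous_on S Y" and w: "continuous_on S w"
    and ind: "\<And>t. t \<in> S \<Longrightarrow> indep_rows UNIV (Y t)"
    and wc: "\<And>t. t \<in> S \<Longrightarrow> w t = (\<Sum>i\<in>UNIV. c t $ i *s Y t $ i)"
  shows "continuous_on S c"
proof -
  define b where "b t = (\<chi> i. hermitian (Y t $ i) (w t))" for t
  let ?G = "\<lambda>t. gram UNIV (Y t)"
  let ?f = "\<lambda>t. \<chi> k. det (\<chi> i j. if j = k then b t $ i else ?G t $ i $ j) / det (?G t)"
  have cf: "c t = ?f t" if "t \<in> S" for t
  proof -
    have "?G t *v c t = b t"
      by (simp add: vec_eq_iff matrix_vector_mult_def gram_def b_def wc[OF that] hermitian_sum_right)
    moreover have "det (?G t) \<noteq> 0"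
      using ind[OF that] by (simp add: det_gram_nonzero_iff)
    ultimately show ?thesis by (simp add: cramer)
  qed
  have "continuous_on S ?f"
  proof (intro continuous_on_vec_lambda continuous_on_divide continuous_on_det_gram Y ballI)
    fix k
    show "continuous_on S (\<lambda>t. det (\<chi> i j. if j = k then b t $ i else ?G t $ i $ j))"
    proof (rule continuous_on_det)
      fix i j
      show "continuous_on S (\<lambda>t. (\<chi> i j. if j = k then b t $ i else ?G t $ i $ j) $ i $ j)"
        by (cases "j = k") (auto simp: b_def gram_def intro!: continuous_on_cdot continuous_intros Y w)
    qed
  qed (use ind in \<open>simp add: det_gram_nonzero_iff\<close>)
  then show ?thesis using cf by (simp cong: continuous_on_cong)
qed

section \<open>Simple connectedness of frame spaces\<close>

lemma differentiable_vec:
  fixes f :: "'a::real_normed_vector \<Rightarrow> ('b::euclidean_space) ^ 'k"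
  assumes "\<And>k. (\<lambda>x. f x $ k) differentiable (at a within S)"
  shows "f differentiable (at a within S)"
proof -
  have "bounded_linear (axis k :: 'b \<Rightarrow> 'b ^ 'k)" for k
    by (intro linear_conv_bounded_linear[THEN iffD1] linearI) (auto simp: vec_eq_iff axis_def)
  then have "(\<lambda>x. axis k (f x $ k)) differentiable (at a within S)" for k
    using assms[of k] bounded_linear.has_derivative unfolding differentiable_def by blast
  then have "(\<lambda>x. \<Sum>k\<in>UNIV. axis k (f x $ k)) differentiable (at a within S)"
    by (intro differentiable_sum) auto
  also have "(\<lambda>x. \<Sum>k\<in>UNIV. axis k (f x $ k)) = f"
    by (auto simp: fun_eq_iff vec_eq_iff axis_def)
  finally show ?thesis .
qed

lemma negligible_coordinate_zero:
  "negligible {y :: complex ^ 'n ^ 'k. y $ i $ m = 0}"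
proof (rule negligible_subset)
  show "negligible {y :: complex ^ 'n ^ 'k. y \<bullet> axis i (axis m 1) = 0}"
    by (rule negligible_standard_hyperplane) (simp add: Basis_complex_def)
  show "{y :: complex ^ 'n ^ 'k. y $ i $ m = 0} \<subseteq> {y. y \<bullet> axis i (axis m 1) = 0}"
    by (auto simp: inner_axis)
qed

text \<open>
  An apex \<open>x\<close> is bad for the loop \<open>g\<close> if a segment from \<open>g t\<close> to \<open>x\<close> passes through a tuple \<open>z\<close> in which some
  row \<open>i\<close> is a combination of the other rows in \<open>K\<close>. Then \<open>z\<close> is determined by its other rows and by
  \<open>card K - 1\<close> coefficients, and \<open>x\<close> in addition by \<open>t\<close> and \<open>s\<close>. All these coefficients, together with the
  single complex number \<open>t + i s\<close>, fit into the \<open>CARD('n)\<close> coordinates of the now redundant row \<open>i\<close>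
  and leave a coordinate over. So the bad apices form a smooth image of a hyperplane in a space of
  the same dimension.
\<close>

lemma negligible_cone_meets_dependent:
  fixes g :: "real \<Rightarrow> complex ^ 'n ^ 'k"
  assumes g: "g differentiable_on UNIV" and K: "card K < CARD('n)"
  shows "negligible {x. \<exists>t s. 0 < s \<and> \<not> indep_rows K ((1 - s) *\<^sub>R g t + s *\<^sub>R x)}"
proof -
  have "\<exists>e :: 'k \<Rightarrow> 'n. e ` K \<subseteq> UNIV \<and> inj_on e K"
    using K by (intro card_le_inj) auto
  then obtain e :: "'k \<Rightarrow> 'n" where e: "inj_on e K" by blast
  have "card (e ` K) < CARD('n)" using K e by (simp add: card_image)
  then obtain m where m: "m \<notin> e ` K" by (metis UNIV_eq_I less_irrefl)
  (* Coordinate e l of row i codes the coefficient of row l, coordinate e i codes t + i s, and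
     coordinate m is the one left over. *)
  define N where "N i = {y :: complex ^ 'n ^ 'k. y $ i $ m = 0 \<and> Im (y $ i $ e i) \<noteq> 0}" for i
  define w where "w i y = (\<chi> j. if j = i then \<Sum>l\<in>K - {i}. y $ i $ e l *s y $ l else y $ j)"
    for i and y :: "complex ^ 'n ^ 'k"
  define F where "F i y = inverse (Im (y $ i $ e i)) *\<^sub>R
      (w i y - (1 - Im (y $ i $ e i)) *\<^sub>R g (Re (y $ i $ e i)))" for i y
  have neg: "negligible (F i ` N i)" for i
  proof (rule negligible_differentiable_image_negligible)
    show "negligible (N i)"
      by (rule negligible_subset[OF negligible_coordinate_zero[of i m]]) (auto simp: N_def)
    have coord: "(\<lambda>y :: complex ^ 'n ^ 'k. y $ a $ b) differentiable (at z within Z)" for a b z Z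
      by (intro bounded_linear_imp_differentiable bounded_linear_compose[OF bounded_linear_vec_nth]
          bounded_linear_vec_nth)
    have Re: "(\<lambda>y :: complex ^ 'n ^ 'k. Re (y $ a $ b)) differentiable (at z within Z)"
      and Im: "(\<lambda>y :: complex ^ 'n ^ 'k. Im (y $ a $ b)) differentiable (at z within Z)" for a b z Z
      by (intro bounded_linear_imp_differentiable bounded_linear_compose[OF bounded_linear_vec_nth]
          bounded_linear_vec_nth bounded_linear_Re bounded_linear_compose[OF bounded_linear_Re]
          bounded_linear_compose[OF bounded_linear_Im])+
    have w: "w i differentiable (at z within Z)" for z Z
    proof (intro differentiable_vec)
      fix k l
      show "(\<lambda>y. w i y $ k $ l) differentiable (at z within Z)"
        by (cases "k = i") (auto simp: w_def intro!: coord differentiable_sum differentiable_mult)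
    qed
    have gd: "(\<lambda>y :: complex ^ 'n ^ 'k. g (Re (y $ i $ e i))) differentiable (at y within N i)" for y
      by (rule differentiable_compose[OF _ Re]) (use g in \<open>simp add: differentiable_on_def\<close>)
    show "F i differentiable_on N i"
      unfolding differentiable_on_def F_def
      by (intro ballI differentiable_scaleR differentiable_diff differentiable_inverse w gd Im
          differentiable_const) (auto simp: N_def)
  qed simp
  have "{x. \<exists>t s. 0 < s \<and> \<not> indep_rows K ((1 - s) *\<^sub>R g t + s *\<^sub>R x)} \<subseteq> (\<Union>i\<in>K. F i ` N i)"
  proof safe
    fix x t s
    define z where "z = (1 - s) *\<^sub>R g t + s *\<^sub>R x"
    assume s: "0 < s" and "\<not> indep_rows K ((1 - s) *\<^sub>R g t + s *\<^sub>R x)"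
    then obtain i c where i: "i \<in> K" and z: "z $ i = (\<Sum>j\<in>K - {i}. c j *s z $ j)"
      by (auto simp: not_indep_rows_iff z_def)
    define y where "y = (\<chi> j. if j = i then (\<chi> b. if b = e i then Complex t s
        else if b \<in> e ` K then c (inv_into K e b) else 0) else z $ j)"
    have ye: "y $ i $ e l = c l" if "l \<in> K - {i}" for l
      using that e i by (auto simp: y_def inj_on_eq_iff[OF e])
    have yi: "y $ i $ e i = Complex t s" and yj: "j \<noteq> i \<Longrightarrow> y $ j = z $ j" for j
      by (auto simp: y_def)
    have "y $ i $ m = 0" using m i by (auto simp: y_def)
    then have "y \<in> N i" using s by (simp add: N_def yi)
    moreover have "w i y = z"
      by (subst vec_eq_iff) (auto simp: w_def yj z ye intro!: sum.cong)
    then have "F i y = x"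
      using s by (simp add: F_def yi z_def)
    ultimately show "x \<in> (\<Union>i\<in>K. F i ` N i)" using i by blast
  qed
  moreover have "negligible (\<Union>i\<in>K. F i ` N i)"
    using neg by (intro negligible_Union) auto
  ultimately show ?thesis by (rule negligible_subset[rotated])
qed

text \<open>
  Any two loops can be contracted to one common apex, after a small homotopy which makes them
  polynomial and hence differentiable. This gives path connectedness as well.
\<close>

theorem simply_connected_indep_rows:
  assumes K: "card K < CARD('n)"
  shows "simply_connected {x :: complex ^ 'n ^ 'k. indep_rows K x}" (is "simply_connected ?U")
proof -
  have poly: "\<exists>p'. p' differentiable_on UNIV \<and> path p' \<and> pathfinish p' = pathstart p' \<and> homotopic_loops ?U p p' \<and> path_image p' \<subseteq> ?U"
    if p: "path p" "pathfinish p = pathstart p" "path_image p \<subseteq> ?U" for p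
  proof -
    obtain d where "d > 0" and d: "\<And>h. path h \<Longrightarrow> pathfinish h = pathstart h \<Longrightarrow>
        (\<And>t. t \<in> {0..1} \<Longrightarrow> norm (h t - p t) < d) \<Longrightarrow> homotopic_loops ?U p h"
      using homotopic_nearby_loops[OF p(1) open_indep_rows p(3,2)] by blast
    obtain p' where p': "polynomial_function p'" "pathstart p' = pathstart p"
      "pathfinish p' = pathfinish p" "\<And>t. t \<in> {0..1} \<Longrightarrow> norm (p' t - p t) < d"
      using path_approx_polynomial_function[OF p(1) \<open>d > 0\<close>] by blast
    have "homotopic_loops ?U p p'"
      using p p' by (intro d path_polynomial_function) auto
    then show ?thesis
      using p' p path_polynomial_function[OF p'(1)]
      by (auto dest: homotopic_loops_imp_subset intro!: exI[of _ p'] differentiable_on_polynomial_function)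
  qed
  show ?thesis
    unfolding simply_connected_def
  proof safe
    fix p q :: "real \<Rightarrow> complex ^ 'n ^ 'k"
    assume pq: "path p" "pathfinish p = pathstart p" "path_image p \<subseteq> ?U"
      "path q" "pathfinish q = pathstart q" "path_image q \<subseteq> ?U"
    obtain p' q' where p': "p' differentiable_on UNIV" "path p'" "pathfinish p' = pathstart p'"
        "homotopic_loops ?U p p'" "path_image p' \<subseteq> ?U"
      and q': "q' differentiable_on UNIV" "path q'" "pathfinish q' = pathstart q'"
        "homotopic_loops ?U q q'" "path_image q' \<subseteq> ?U"
      using poly pq by meson
    let ?B = "\<lambda>g. {x. \<exists>t s. 0 < s \<and> \<not> indep_rows K ((1 - s) *\<^sub>R g t + s *\<^sub>R x)}"
    have "negligible (?B p' \<union> ?B q')"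
      by (intro negligible_Un negligible_cone_meets_dependent p' q' K)
    then have "?B p' \<union> ?B q' \<noteq> UNIV" by (metis non_negligible_UNIV)
    then obtain x where x: "x \<notin> ?B p'" "x \<notin> ?B q'" by blast
    have cone: "homotopic_loops ?U g (linepath x x)"
      if g: "path g" "pathfinish g = pathstart g" "path_image g \<subseteq> ?U" "x \<notin> ?B g" for g
    proof (rule homotopic_loops_linear)
      fix t :: real assume t: "t \<in> {0..1}"
      show "closed_segment (g t) (linepath x x t) \<subseteq> ?U"
      proof
        fix z assume "z \<in> closed_segment (g t) (linepath x x t)"
        then obtain s where s: "0 \<le> s" "z = (1 - s) *\<^sub>R g t + s *\<^sub>R x"
          by (auto simp: closed_segment_def linepath_def algebra_simps)
        show "z \<in> ?U"
        proof (cases "s = 0")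
          case True
          then have "z \<in> path_image g" using t s by (simp add: path_image_def)
          then show ?thesis using g(3) by blast
        next
          case False
          then show ?thesis using g(4) s by auto
        qed
      qed
    qed (use g in auto)
    have "homotopic_loops ?U p (linepath x x)" "homotopic_loops ?U q (linepath x x)"
      using p' q' cone x homotopic_loops_trans by blast+
    then show "homotopic_loops ?U p q"
      using homotopic_loops_sym homotopic_loops_trans by blast
  qed
qed

section \<open>Matrices of determinant one\<close>

definition set_row :: "'k \<Rightarrow> 'a ^ 'k \<Rightarrow> 'a \<Rightarrow> 'a ^ 'k" where
  "set_row r x y = (\<chi> i. if i = r then y else x $ i)"

lemma continuous_on_vector_smult [continuous_intros]:
  fixes f :: "'a::topological_space \<Rightarrow> complex" and g :: "'a \<Rightarrow> complex ^ 'n"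
  assumes "continuous_on S f" "continuous_on S g"
  shows "continuous_on S (\<lambda>t. f t *s g t)"
  unfolding vector_scalar_mult_def by (intro continuous_intros assms)

lemma continuous_on_set_row [continuous_intros]:
  fixes f :: "'a::topological_space \<Rightarrow> 'b::topological_space ^ 'k"
  assumes "continuous_on S f" "continuous_on S g"
  shows "continuous_on S (\<lambda>t. set_row r (f t) (g t))"
  unfolding set_row_def
proof (rule continuous_on_vec_lambda)
  show "continuous_on S (\<lambda>t. if i = r then g t else f t $ i)" for i
    using assms by (cases "i = r") (auto intro: continuous_intros)
qed

definition cofactor_row :: "'n \<Rightarrow> complex ^ 'n ^ 'n \<Rightarrow> complex ^ 'n" where
  "cofactor_row r x = (\<chi> m. det (set_row r x (axis m 1)))"

lemma det_set_row: "det (set_row r x y) = (\<Sum>m\<in>UNIV. y $ m * cofactor_row r x $ m)"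
proof -
  have "det (set_row r x y)
      = det (\<chi> i. if i = r then \<Sum>m\<in>UNIV. y $ m *s axis m 1 else x $ i)"
    by (simp only: set_row_def basis_expansion)
  also have "\<dots> = (\<Sum>m\<in>UNIV. det (\<chi> i. if i = r then y $ m *s axis m 1 else x $ i))"
    by (rule det_linear_row_sum) simp
  finally show ?thesis
    by (simp add: det_row_mul cofactor_row_def set_row_def)
qed

text \<open>
  The remaining rows span a proper subspace, and any vector outside of it completes them to an
  invertible matrix.
\<close>

lemma cofactor_row_nonzero:
  fixes x :: "complex ^ 'n ^ 'n"
  assumes "indep_rows (- {r}) x"
  shows "cofactor_row r x \<noteq> 0"
proof -
  let ?W = "vec.span ((\<lambda>i. x $ i) ` (- {r}))"
  have "vec.dim ?W \<le> card ((\<lambda>i. x $ i) ` (- {r}))"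
    by (simp add: vec.dim_le_card')
  also have "\<dots> \<le> card (- {r})"
    by (rule card_image_le) simp
  also have "\<dots> < CARD('n)"
    by (intro psubset_card_mono) auto
  finally have "?W \<noteq> UNIV"
    by (metis less_irrefl vec_dim_card)
  then obtain y where y: "y \<notin> ?W" by blast
  have "indep_rows UNIV (set_row r x y)"
    unfolding indep_rows_def
  proof (intro allI impI)
    fix c assume "(\<Sum>i\<in>UNIV. c i *s set_row r x y $ i) = 0"
    then have 0: "c r *s y + (\<Sum>i\<in>- {r}. c i *s x $ i) = 0"
      by (simp add: sum.remove[of UNIV r] set_row_def Compl_eq_Diff_UNIV cong: sum.cong_simp)
    have S: "(\<Sum>i\<in>- {r}. c i *s x $ i) \<in> ?W"
      by (intro vec.span_sum vec.span_scale vec.span_base) auto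
    have "c r = 0"
    proof (rule ccontr)
      assume "c r \<noteq> 0"
      then have "y = inverse (c r) *s (c r *s y)"
        by (simp add: vector_smult_assoc)
      also have "c r *s y = - (\<Sum>i\<in>- {r}. c i *s x $ i)"
        using 0 by (simp add: eq_neg_iff_add_eq_0)
      also have "inverse (c r) *s - (\<Sum>i\<in>- {r}. c i *s x $ i) \<in> ?W"
        by (intro vec.span_scale vec.span_neg S)
      finally show False using y by contradiction
    qed
    moreover have "\<forall>i\<in>- {r}. c i = 0"
      using assms 0 \<open>c r = 0\<close> unfolding indep_rows_def by simp
    ultimately show "\<forall>i\<in>UNIV. c i = 0" by auto
  qed
  then have "det (set_row r x y) \<noteq> 0" by (simp add: indep_rows_iff_det)
  then show ?thesis by (auto simp: det_set_row)
qed

text \<open>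
  Given that the other rows are independent, one row can be corrected to make the determinant one:
  the conjugated cofactors, suitably normalized, are a vector \<open>c x\<close> which as row \<open>r\<close> would give
  determinant one, and adding \<open>(1 - det x) c x\<close> to row \<open>r\<close> changes nothing if the determinant is
  already one. This is a retraction from a space of \<open>(m - 1)\<close>-frames with a free extra row.
\<close>

theorem simply_connected_det_1: "simply_connected {x :: complex ^ 'n ^ 'n. det x = 1}"
proof -
  define r :: 'n where "r = undefined"
  let ?U = "{x :: complex ^ 'n ^ 'n. indep_rows (- {r}) x}"
  let ?SL = "{x :: complex ^ 'n ^ 'n. det x = 1}"
  define c where "c x = (\<chi> m. cnj (cofactor_row r x $ m) / hermitian (cofactor_row r x) (cofactor_row r x))"
    for x :: "complex ^ 'n ^ 'n"
  define \<rho> where "\<rho> x = set_row r x (x $ r + (1 - det x) *s c x)" for x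
  have set_same: "set_row r x (x $ r) = x" for x :: "complex ^ 'n ^ 'n"
    by (simp add: set_row_def vec_eq_iff)
  have det\<rho>: "det (\<rho> x) = 1" if "x \<in> ?U" for x
  proof -
    have "det (set_row r x (c x)) = 1"
      using cofactor_row_nonzero that
      by (simp add: det_set_row c_def hermitian_self_eq_0 flip: sum_divide_distrib) (simp add: hermitian_def)
    moreover have "det (\<rho> x) = det (set_row r x (x $ r)) + (1 - det x) * det (set_row r x (c x))"
      by (simp add: \<rho>_def det_set_row algebra_simps sum.distrib sum_distrib_left sum_subtractf)
    ultimately show ?thesis by (simp add: set_same)
  qed
  have "retraction ?U ?SL \<rho>"
    unfolding retraction_def
  proof safe
    fix x :: "complex ^ 'n ^ 'n" assume "det x = 1"
    then show "indep_rows (- {r}) x"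
      using indep_rows_mono[of UNIV x] by (simp add: indep_rows_iff_det)
    show "\<rho> x = x" using \<open>det x = 1\<close> by (simp add: \<rho>_def set_same)
  next
    have cof: "continuous_on ?U (\<lambda>x. cofactor_row r x)"
      unfolding cofactor_row_def
      by (intro continuous_on_vec_lambda continuous_on_det continuous_intros)
    have d: "continuous_on ?U (\<lambda>x. det x)"
      by (intro continuous_on_det continuous_intros)
    have cc: "continuous_on ?U c"
      unfolding c_def
      by (intro continuous_intros cof continuous_on_cdot)
         (use cofactor_row_nonzero in \<open>auto simp: hermitian_self_eq_0\<close>)
    show "continuous_on ?U \<rho>"
      unfolding \<rho>_def by (intro continuous_intros d cc)
  qed (use det\<rho> in auto)
  then have "?SL retract_of ?U" by (auto simp: retract_of_def)
  moreover have "simply_connected ?U"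
  proof (rule simply_connected_indep_rows)
    show "card (- {r}) < CARD('n)" by (intro psubset_card_mono) auto
  qed
  ultimately show ?thesis using retract_of_simply_connected by blast
qed

section \<open>A fourfold covering of a set of quartic expressions\<close>

definition cscale :: "complex \<Rightarrow> complex ^ 'n ^ 'k \<Rightarrow> complex ^ 'n ^ 'k" where
  "cscale \<mu> x = (\<chi> i. \<mu> *s x $ i)"

lemma cscale_nth [simp]: "cscale \<mu> x $ i = \<mu> *s x $ i"
  by (simp add: cscale_def)

lemma cscale_cscale [simp]: "cscale \<mu> (cscale \<nu> x) = cscale (\<mu> * \<nu>) x"
  by (simp add: cscale_def vector_smult_assoc)

lemma cscale_1 [simp]: "cscale 1 x = x"
  by (simp add: vec_eq_iff)

lemma continuous_on_cscale [continuous_intros]: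
  fixes f :: "'a::topological_space \<Rightarrow> complex"
  assumes "continuous_on S f" "continuous_on S g"
  shows "continuous_on S (\<lambda>t. cscale (f t) (g t))"
  unfolding cscale_def by (intro continuous_intros assms)

lemma indep_rows_cscale:
  fixes x :: "complex ^ 'n ^ 'k"
  assumes "\<mu> \<noteq> 0"
  shows "indep_rows K (cscale \<mu> x) \<longleftrightarrow> indep_rows K x"
proof -
  have *: "indep_rows K (cscale \<mu> x)" if "indep_rows K x" "\<mu> \<noteq> 0" for \<mu> and x :: "complex ^ 'n ^ 'k"
    unfolding indep_rows_def
  proof (intro allI impI)
    fix c assume "(\<Sum>i\<in>K. c i *s cscale \<mu> x $ i) = 0"
    then have "(\<Sum>i\<in>K. (c i * \<mu>) *s x $ i) = 0" by (simp add: vector_smult_assoc)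
    then have "\<forall>i\<in>K. c i * \<mu> = 0"
      using that(1) unfolding indep_rows_def by (metis (no_types))
    then show "\<forall>i\<in>K. c i = 0" using that(2) by simp
  qed
  show ?thesis
    using *[of x \<mu>] *[of "cscale \<mu> x" "inverse \<mu>"] assms by auto
qed

lemma det_cscale:
  fixes x :: "complex ^ 'n ^ 'n"
  shows "det (cscale \<mu> x) = \<mu> ^ CARD('n) * det x"
  using det_rows_mul[of "\<lambda>_. \<mu>" "\<lambda>i. x $ i"] by (simp add: cscale_def)

text \<open>
  All products of the third power of one entry with an arbitrary entry. They suffice to detect the orbit
  under fourth roots of unity: where an entry is nonzero, its fourth power and its quotients with
  the other entries can be read off.
\<close>

definition quartic :: "complex ^ 'n ^ 'k \<Rightarrow> complex ^ 'n ^ 'k ^ 'n ^ 'k" where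
  "quartic x = (\<chi> i j k l. (x $ i $ j) ^ 3 * x $ k $ l)"

lemma quartic_cscale: "quartic (cscale \<mu> x) = (\<chi> i j k l. \<mu> ^ 4 * quartic x $ i $ j $ k $ l)"
  by (simp add: quartic_def vec_eq_iff power_mult_distrib power4_eq_xxxx power3_eq_cube mult_ac)

lemma quartic_eq_iff:
  assumes "x \<noteq> 0"
  shows "quartic x = quartic y \<longleftrightarrow> (\<exists>\<zeta>. \<zeta> ^ 4 = 1 \<and> y = cscale \<zeta> x)"
proof
  assume eq: "quartic x = quartic y"
  obtain i j where x: "x $ i $ j \<noteq> 0" using assms by (auto simp: vec_eq_iff)
  have *: "(x $ i $ j) ^ 3 * x $ k $ l = (y $ i $ j) ^ 3 * y $ k $ l" for k l
    using arg_cong[OF eq, of "\<lambda>Y. Y $ i $ j $ k $ l"] by (simp add: quartic_def)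
  have 4: "(x $ i $ j) ^ 4 = (y $ i $ j) ^ 4"
    using *[of i j] by (simp add: power4_eq_xxxx power3_eq_cube mult.assoc)
  then have y: "y $ i $ j \<noteq> 0" using x by auto
  let ?\<zeta> = "(x $ i $ j) ^ 3 / (y $ i $ j) ^ 3"
  have "?\<zeta> ^ 4 = ((x $ i $ j) ^ 4) ^ 3 / ((y $ i $ j) ^ 4) ^ 3"
    by (simp add: power_divide flip: power_mult)
  then have "?\<zeta> ^ 4 = 1" using 4 y by simp
  moreover have "y = cscale ?\<zeta> x"
    using * y by (simp add: vec_eq_iff field_simps)
  ultimately show "\<exists>\<zeta>. \<zeta> ^ 4 = 1 \<and> y = cscale \<zeta> x" by blast
qed (auto simp: quartic_cscale)

lemma continuous_on_quartic:
  assumes "continuous_on S f"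
  shows "continuous_on S (\<lambda>t. quartic (f t))"
  unfolding quartic_def by (intro continuous_intros assms)

text \<open>
  Near a point with \<open>x\<^sub>i\<^sub>j \<noteq> 0\<close> the map is a pullback of \<open>z \<mapsto> z\<^sup>4\<close> on the punctured plane: a local choice of
  \<open>z = x\<^sub>i\<^sub>j\<close> with \<open>z\<^sup>4\<close> prescribed determines every other entry as \<open>x\<^sub>i\<^sub>j\<^sup>3 x\<^sub>k\<^sub>l / z\<^sup>3\<close>. In size four, fourth roots
  of unity preserve the determinant, so all four choices stay in the special linear group.
\<close>

lemma covering_space_quartic:
  assumes card: "CARD('n) = 4"
  defines "SL \<equiv> {x :: complex ^ 'n ^ 'n. det x = 1}"
  shows "covering_space SL quartic (quartic ` SL)"
proof (rule covering_spaceI)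
  show "continuous_on SL quartic" by (intro continuous_on_quartic continuous_on_id)
next
  fix Y assume "Y \<in> quartic ` SL"
  then obtain x0 where x0: "x0 \<in> SL" and Y: "Y = quartic x0" by blast
  have "det (0 :: complex ^ 'n ^ 'n) = 0"
    by (intro det_zero_row(2)[of undefined]) (simp add: row_def vec_eq_iff)
  then have "x0 \<noteq> 0" using x0 by (auto simp: SL_def)
  then obtain i j where nz: "x0 $ i $ j \<noteq> 0" by (auto simp: vec_eq_iff)
  let ?e = "\<lambda>Y :: complex ^ 'n ^ 'n ^ 'n ^ 'n. Y $ i $ j $ i $ j"
  have e: "?e (quartic x) = (x $ i $ j) ^ 4" for x
    by (simp add: quartic_def power4_eq_xxxx power3_eq_cube mult.assoc)
  have "covering_space (- {0}) (\<lambda>z::complex. z ^ 4) (- {0})"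
    by (rule covering_space_power_punctured_plane) simp
  then have "\<forall>y\<in>- {0}. \<exists>T. y \<in> T \<and> openin (top_of_set (- {0})) T \<and>
      (\<exists>v. \<Union>v = - {0} \<inter> (\<lambda>z. z ^ 4) -` T \<and> (\<forall>u\<in>v. openin (top_of_set (- {0})) u) \<and>
        pairwise disjnt v \<and> (\<forall>u\<in>v. \<exists>h. homeomorphism u T (\<lambda>z::complex. z ^ 4) h))"
    by (simp add: covering_space_def)
  moreover have "(x0 $ i $ j) ^ 4 \<in> - {0}" using nz by simp
  ultimately obtain T v where T: "(x0 $ i $ j) ^ 4 \<in> T" "openin (top_of_set (- {0})) T"
    and v: "\<Union>v = - {0} \<inter> (\<lambda>z. z ^ 4) -` T"
      "\<forall>u\<in>v. openin (top_of_set (- {0})) u" "pairwise disjnt v"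
      "\<forall>u\<in>v. \<exists>h. homeomorphism u T (\<lambda>z::complex. z ^ 4) h"
    by meson
  have oT: "open T" and T0: "T \<subseteq> - {0}"
    using T(2) by (auto simp: openin_open_eq open_Compl)
  define T' where "T' = {Z \<in> quartic ` SL. ?e Z \<in> T}"
  define V where "V u = {x \<in> SL. x $ i $ j \<in> u}" for u
  have "openin (top_of_set (quartic ` SL)) T'"
  proof -
    have "T' = quartic ` SL \<inter> ?e -` T" by (auto simp: T'_def)
    moreover have "open (?e -` T)"
      by (intro open_vimage oT continuous_intros)
    ultimately show ?thesis by (auto simp: openin_open)
  qed
  moreover have "Y \<in> T'" using x0 T(1) by (simp add: T'_def Y e)
  moreover have "\<Union>(V ` v) = SL \<inter> quartic -` T'"
  proof -
    have "x $ i $ j \<in> \<Union>v \<longleftrightarrow> (x $ i $ j) ^ 4 \<in> T" for x :: "complex ^ 'n ^ 'n"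
      unfolding v(1) using T0 by auto
    then show ?thesis unfolding V_def T'_def by (auto simp: e)
  qed
  moreover have "\<forall>U\<in>V ` v. openin (top_of_set SL) U"
  proof safe
    fix u assume "u \<in> v"
    then have "open u" using v(2) by (auto simp: openin_open_eq open_Compl)
    then have "open ((\<lambda>x :: complex ^ 'n ^ 'n. x $ i $ j) -` u)"
      by (intro open_vimage continuous_intros)
    moreover have "V u = SL \<inter> (\<lambda>x. x $ i $ j) -` u" by (auto simp: V_def)
    ultimately show "openin (top_of_set SL) (V u)" by (auto simp: openin_open)
  qed
  moreover have "pairwise disjnt (V ` v)"
  proof (rule pairwise_imageI)
    fix u w assume "u \<in> v" "w \<in> v" "u \<noteq> w"
    then have "disjnt u w" using v(3) by (auto simp: pairwise_def)
    then show "disjnt (V u) (V w)" by (auto simp: V_def disjnt_iff)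
  qed
  moreover have "\<forall>U\<in>V ` v. \<exists>q. homeomorphism U T' quartic q"
  proof safe
    fix u assume u: "u \<in> v"
    then obtain h where h: "homeomorphism u T (\<lambda>z::complex. z ^ 4) h" using v(4) by blast
    have hu: "h z \<in> u" "h z ^ 4 = z" if "z \<in> T" for z
      using h that by (auto simp: homeomorphism_def)
    have hz: "h (z ^ 4) = z" if "z \<in> u" for z
      using h that by (auto simp: homeomorphism_def)
    have uT: "z ^ 4 \<in> T" "z \<noteq> 0" if "z \<in> u" for z
      using u v(1) that by auto
    define g where "g Z = (\<chi> k l. Z $ i $ j $ k $ l / h (?e Z) ^ 3)" for Z
    have gq: "g (quartic x) = cscale ((x $ i $ j) ^ 3 / h ((x $ i $ j) ^ 4) ^ 3) x" for x
      unfolding g_def e by (simp add: quartic_def vec_eq_iff)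
    have main: "g Z \<in> V u \<and> quartic (g Z) = Z" if Z: "Z \<in> T'" for Z
    proof -
      obtain x where x: "det x = 1" and Zx: "Z = quartic x" and t: "(x $ i $ j) ^ 4 \<in> T"
        using Z by (auto simp: T'_def SL_def e)
      define z where "z = h ((x $ i $ j) ^ 4)"
      define \<zeta> where "\<zeta> = (x $ i $ j) ^ 3 / z ^ 3"
      have z4: "z ^ 4 = (x $ i $ j) ^ 4" and zu: "z \<in> u" using hu[OF t] by (auto simp: z_def)
      have z0: "z \<noteq> 0" using uT zu by auto
      then have x0: "x $ i $ j \<noteq> 0" using z4 by auto
      have "\<zeta> ^ 4 = ((x $ i $ j) ^ 4) ^ 3 / (z ^ 4) ^ 3"
        by (simp add: \<zeta>_def power_divide flip: power_mult)
      then have \<zeta>: "\<zeta> ^ 4 = 1" using z4 z0 x0 by simp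
      have gZ: "g Z = cscale \<zeta> x" by (simp add: Zx gq \<zeta>_def z_def)
      have "g Z $ i $ j = (x $ i $ j) ^ 4 / z ^ 3"
        by (simp add: gZ \<zeta>_def power4_eq_xxxx power3_eq_cube)
      also have "\<dots> = z ^ 4 / z ^ 3" by (simp only: z4)
      also have "\<dots> = z" using z0 by (simp add: power4_eq_xxxx power3_eq_cube)
      finally have "g Z $ i $ j \<in> u" using zu by simp
      moreover have "det (g Z) = 1" by (simp add: gZ det_cscale card \<zeta> x)
      moreover have "quartic (g Z) = Z" unfolding gZ by (simp add: Zx quartic_cscale \<zeta>)
      ultimately show ?thesis by (simp add: V_def SL_def)
    qed
    have "homeomorphism (V u) T' quartic g"
    proof (rule homeomorphismI)
      show "continuous_on (V u) quartic" by (intro continuous_on_quartic continuous_on_id)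
      have ch: "continuous_on T' (\<lambda>Z. h (?e Z))"
      proof (rule continuous_on_compose2[of T h])
        show "continuous_on T h" using h by (simp add: homeomorphism_def)
        show "continuous_on T' ?e" by (intro continuous_intros)
      qed (auto simp: T'_def)
      have "h (?e Z) \<noteq> 0" if "Z \<in> T'" for Z
        using that hu(1) uT(2) by (auto simp: T'_def)
      then show "continuous_on T' g"
        unfolding g_def by (intro continuous_intros ch) auto
      show "quartic ` V u \<subseteq> T'" using uT by (auto simp: T'_def V_def e)
      show "g (quartic x) = x" if "x \<in> V u" for x
        using that uT hz by (auto simp: V_def gq)
    qed (use main in auto)
    then show "\<exists>q. homeomorphism (V u) T' quartic q" by blast
  qed
  ultimately show "\<exists>T. Y \<in> T \<and> openin (top_of_set (quartic ` SL)) T \<and>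
      (\<exists>v. \<Union>v = SL \<inter> quartic -` T \<and> (\<forall>u\<in>v. openin (top_of_set SL) u) \<and>
        pairwise disjnt v \<and> (\<forall>u\<in>v. \<exists>q. homeomorphism u T quartic q))"
    by blast
qed simp

section \<open>Points and lines in projective space\<close>

lemma line_of_proj_point: "v \<noteq> 0 \<Longrightarrow> line_of (proj_point v) = vec.span {v}"
  unfolding proj_point_def
  by (rule Abs_cproj_inverse) (simp add: dim_span_singleton vec.subspace_span del: vec.dim_span)

lemma proj_point_cases:
  obtains v where "v \<noteq> 0" "P = proj_point v"
proof -
  have P: "vec.subspace (line_of P)" "vec.dim (line_of P) = 1"
    using line_of[of P] by auto
  obtain B where B: "B \<subseteq> line_of P" "vec.independent B" "line_of P \<subseteq> vec.span B"
      "card B = vec.dim (line_of P)"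
    using vec.basis_exists by blast
  obtain v where v: "B = {v}" using B(4) P(2) card_1_singletonE by metis
  then have "v \<noteq> 0" using B(2) by (auto simp: vec.dependent_single)
  moreover have "line_of P = vec.span {v}"
    using B(1,3) P(1) v by (simp add: vec.span_minimal antisym)
  ultimately show ?thesis
    using that line_of_proj_point line_of_inject by metis
qed

lemma span_singleton_subset_iff: "vec.span {v} \<subseteq> vec.span S \<longleftrightarrow> v \<in> vec.span S"
  using vec.span_superset[of "{v}"] vec.span_minimal[of "{v}" "vec.span S"] vec.subspace_span by blast

lemma proj_span_proj_points:
  assumes "0 \<notin> S"
  shows "proj_span (proj_point ` S) = {P. line_of P \<subseteq> vec.span S}"
proof -
  have "vec.span (\<Union>Q\<in>proj_point ` S. line_of Q) = vec.span S"
  proof (subst vec.span_eq, intro conjI subsetI)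
    fix v assume "v \<in> (\<Union>Q\<in>proj_point ` S. line_of Q)"
    then obtain s where s: "s \<in> S" "v \<in> line_of (proj_point s)" by blast
    then have "s \<noteq> 0" using assms by auto
    then have "v \<in> vec.span {s}" using s line_of_proj_point by blast
    then show "v \<in> vec.span S"
      using vec.span_mono[of "{s}" S] s by auto
  next
    fix v assume v: "v \<in> S"
    then have "v \<noteq> 0" using assms by auto
    then have "v \<in> line_of (proj_point v)"
      by (simp add: line_of_proj_point vec.span_base)
    then show "v \<in> vec.span (\<Union>Q\<in>proj_point ` S. line_of Q)"
      using v by (blast intro: vec.span_base)
  qed
  then show ?thesis by (simp add: proj_span_def)
qed

lemma proj_point_in_line_iff:
  assumes "u \<noteq> 0" "a \<noteq> 0" "b \<noteq> 0"
  shows "proj_point u \<in> proj_line (proj_point a) (proj_point b) \<longleftrightarrow> (\<exists>s t. u = s *s a + t *s b)"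
proof -
  have "proj_point u \<in> proj_line (proj_point a) (proj_point b) \<longleftrightarrow> u \<in> vec.span {a, b}"
    using proj_span_proj_points[of "{a, b}"] assms
    by (simp add: line_of_proj_point span_singleton_subset_iff)
  also have "\<dots> \<longleftrightarrow> (\<exists>s t. u = s *s a + t *s b)"
    by (simp add: vec.span_breakdown_eq diff_eq_eq) (metis add.commute)
  finally show ?thesis .
qed

lemma proj_point_scale:
  assumes "c \<noteq> 0"
  shows "proj_point (c *s u) = proj_point u"
proof -
  have "u = inverse c *s (c *s u)" using assms by (simp add: vector_smult_assoc)
  then have "u \<in> vec.span {c *s u}" by (metis singletonI vec.span_base vec.span_scale)
  moreover have "c *s u \<in> vec.span {u}" by (intro vec.span_scale vec.span_base) simp
  ultimately have "vec.span {c *s u} = vec.span {u}" by (subst vec.span_eq) simp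
  then show ?thesis by (simp add: proj_point_def)
qed

lemma proj_point_eq_iff:
  assumes "u \<noteq> 0" "v \<noteq> 0"
  shows "proj_point u = proj_point v \<longleftrightarrow> (\<exists>c. c \<noteq> 0 \<and> v = c *s u)"
proof
  assume "proj_point u = proj_point v"
  then have "v \<in> vec.span {u}"
    using assms line_of_proj_point vec.span_base by (metis singletonI)
  then obtain c where "v = c *s u" by (auto simp: vec.span_singleton)
  then show "\<exists>c. c \<noteq> 0 \<and> v = c *s u" using assms(2) by auto
next
  assume "\<exists>c. c \<noteq> 0 \<and> v = c *s u"
  then obtain c where c: "c \<noteq> 0" "v = c *s u" by blast
  then show "proj_point u = proj_point v" by (simp add: proj_point_scale)
qed

lemma continuous_on_proj_point: "continuous_on (- {0}) (proj_point :: complex ^ 'n \<Rightarrow> _)"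
proof (subst continuous_on_open_vimage)
  show "open (- {0 :: complex ^ 'n})" by (simp add: open_Compl)
  show "\<forall>B. open B \<longrightarrow> open (proj_point -` B \<inter> - {0 :: complex ^ 'n})"
  proof safe
    fix B :: "'n cproj set" assume "open B"
    then have "open {v :: complex ^ 'n. v \<noteq> 0 \<and> proj_point v \<in> B}" by (simp add: open_cproj_def)
    also have "{v :: complex ^ 'n. v \<noteq> 0 \<and> proj_point v \<in> B} = proj_point -` B \<inter> - {0}" by auto
    finally show "open (proj_point -` B \<inter> - {0 :: complex ^ 'n})" .
  qed
qed

text \<open>
  The section on the affine chart where coordinate \<open>m\<close> does not vanish picks the representative whose
  coordinate \<open>m\<close> is one.
\<close>

lemma proj_point_local_section:
  fixes P :: "'n::finite cproj"
  obtains U \<sigma> where "open U" "P \<in> U" "continuous_on U \<sigma>"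
    "\<And>Q. Q \<in> U \<Longrightarrow> \<sigma> Q \<noteq> 0 \<and> proj_point (\<sigma> Q) = Q"
proof -
  obtain v where v: "v \<noteq> 0" "P = proj_point v" by (rule proj_point_cases)
  then obtain m where m: "v $ m \<noteq> 0" by (auto simp: vec_eq_iff)
  define U where "U = {Q :: 'n cproj. \<exists>w. w $ m \<noteq> 0 \<and> Q = proj_point w}"
  define \<sigma> where "\<sigma> Q = (SOME w. w $ m = 1 \<and> Q = proj_point w)" for Q :: "'n cproj"
  have nz: "w \<noteq> 0" if "w $ m \<noteq> 0" for w :: "complex ^ 'n" using that by auto
  have \<sigma>: "\<sigma> (proj_point w) = inverse (w $ m) *s w" if w: "w $ m \<noteq> 0" for w
    unfolding \<sigma>_def
  proof (rule some_equality)
    have "inverse (w $ m) *s w \<noteq> 0" using w by (auto simp: vec_eq_iff)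
    then show "(inverse (w $ m) *s w) $ m = 1 \<and> proj_point w = proj_point (inverse (w $ m) *s w)"
      using w by (subst proj_point_eq_iff) (auto intro!: exI[of _ "inverse (w $ m)"])
  next
    fix u assume u: "u $ m = 1 \<and> proj_point w = proj_point u"
    then have "\<exists>c. c \<noteq> 0 \<and> u = c *s w" using w nz by (subst proj_point_eq_iff[symmetric]) auto
    then obtain c where "u = c *s w" by blast
    with u w show "u = inverse (w $ m) *s w" by (auto simp: field_simps)
  qed
  have sec: "\<sigma> Q \<noteq> 0 \<and> proj_point (\<sigma> Q) = Q" if Q: "Q \<in> U" for Q
  proof -
    obtain w where w: "w $ m \<noteq> 0" "Q = proj_point w" using Q by (auto simp: U_def)
    have "inverse (w $ m) *s w \<noteq> 0" using w by (auto simp: vec_eq_iff)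
    then show ?thesis
      using w nz by (simp add: \<sigma>) (subst proj_point_eq_iff, auto intro!: exI[of _ "w $ m"] simp: vector_smult_assoc)
  qed
  have pU: "proj_point w \<in> U \<longleftrightarrow> w $ m \<noteq> 0" if "w \<noteq> 0" for w
  proof
    assume "proj_point w \<in> U"
    then obtain u where u: "u $ m \<noteq> 0" "proj_point w = proj_point u" by (auto simp: U_def)
    then have "\<exists>c. c \<noteq> 0 \<and> u = c *s w"
      using that nz[OF u(1)] by (simp add: proj_point_eq_iff)
    then obtain c where "u = c *s w" by blast
    then show "w $ m \<noteq> 0" using u by auto
  qed (auto simp: U_def)
  have "{w. w \<noteq> 0 \<and> proj_point w \<in> U} = {w. w $ m \<noteq> 0}" using pU nz by blast
  moreover have "open {w :: complex ^ 'n. w $ m \<noteq> 0}"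
    by (intro open_Collect_neq continuous_intros)
  ultimately have "open U" by (simp add: open_cproj_def)
  moreover have "P \<in> U" using m v by (auto simp: U_def)
  moreover have "continuous_on U \<sigma>"
  proof (subst continuous_on_open_vimage[OF \<open>open U\<close>], intro allI impI)
    fix B :: "(complex ^ 'n) set" assume B: "open B"
    have "{w. w \<noteq> 0 \<and> proj_point w \<in> \<sigma> -` B \<inter> U} = {w. w $ m \<noteq> 0} \<inter> (\<lambda>w. inverse (w $ m) *s w) -` B"
      using pU nz \<sigma> by auto
    moreover have "open ({w. w $ m \<noteq> 0} \<inter> (\<lambda>w. inverse (w $ m) *s w) -` B)"
    proof -
      have "continuous_on {w :: complex ^ 'n. w $ m \<noteq> 0} (\<lambda>w. inverse (w $ m) *s w)"
        by (intro continuous_intros) auto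
      then have "open ((\<lambda>w. inverse (w $ m) *s w) -` B \<inter> {w :: complex ^ 'n. w $ m \<noteq> 0})"
        using B \<open>open {w :: complex ^ 'n. w $ m \<noteq> 0}\<close> by (simp add: continuous_on_open_vimage)
      then show ?thesis by (simp add: Int_commute)
    qed
    ultimately show "open (\<sigma> -` B \<inter> U)" by (simp add: open_cproj_def)
  qed
  ultimately show ?thesis using that sec by blast
qed

section \<open>Desargues configurations as frames up to scaling\<close>

text \<open>
  The index type is left open because two instances are needed: the type \<open>4\<close> for arbitrary ambient
  dimension, and the coordinate type itself when the frames are square matrices.
\<close>

locale four_rows =
  fixes k0 k1 k2 k3 :: "'k::finite"
  assumes distinct_rows: "distinct [k0, k1, k2, k3]"
    and all_rows: "UNIV = {k0, k1, k2, k3}"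
begin

lemma sum_rows: "(\<Sum>i\<in>UNIV. f i) = f k0 + f k1 + f k2 + f k3"
  for f :: "'k \<Rightarrow> 'b::comm_monoid_add"
  using distinct_rows by (simp add: all_rows add.assoc)

lemma card_rows: "CARD('k) = 4"
  using distinct_rows by (simp add: all_rows)

definition lincomb :: "complex ^ 'n ^ 'k \<Rightarrow> complex \<Rightarrow> complex \<Rightarrow> complex \<Rightarrow> complex \<Rightarrow> complex ^ 'n" where
  "lincomb x a b c d = a *s x $ k0 + b *s x $ k1 + c *s x $ k2 + d *s x $ k3"

lemma row_lincomb: "x $ k0 = lincomb x 1 0 0 0" "x $ k1 = lincomb x 0 1 0 0"
    "x $ k2 = lincomb x 0 0 1 0" "x $ k3 = lincomb x 0 0 0 1"
  by (simp_all add: lincomb_def)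

lemma lincomb_add: "lincomb x a b c d + lincomb x a' b' c' d' = lincomb x (a + a') (b + b') (c + c') (d + d')"
  by (simp add: lincomb_def vec_eq_iff algebra_simps)

lemma lincomb_diff: "lincomb x a b c d - lincomb x a' b' c' d' = lincomb x (a - a') (b - b') (c - c') (d - d')"
  by (simp add: lincomb_def vec_eq_iff algebra_simps)

lemma lincomb_scale: "s *s lincomb x a b c d = lincomb x (s * a) (s * b) (s * c) (s * d)"
  by (simp add: lincomb_def vec_eq_iff algebra_simps)

lemmas lincomb_simps = lincomb_add lincomb_diff lincomb_scale

lemma indep_rows_iff_lincomb:
  "indep_rows UNIV x \<longleftrightarrow> (\<forall>a b c d. lincomb x a b c d = 0 \<longrightarrow> a = 0 \<and> b = 0 \<and> c = 0 \<and> d = 0)"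
proof
  assume ind: "indep_rows UNIV x"
  show "\<forall>a b c d. lincomb x a b c d = 0 \<longrightarrow> a = 0 \<and> b = 0 \<and> c = 0 \<and> d = 0"
  proof (intro allI impI)
    fix a b c d assume 0: "lincomb x a b c d = 0"
    define f where "f = (\<lambda>_. d)(k0 := a, k1 := b, k2 := c)"
    have f: "f k0 = a" "f k1 = b" "f k2 = c" "f k3 = d"
      using distinct_rows by (auto simp: f_def)
    have "(\<Sum>i\<in>UNIV. f i *s x $ i) = 0" using 0 by (simp add: sum_rows f lincomb_def)
    then have "\<forall>i\<in>UNIV. f i = 0" using ind unfolding indep_rows_def by blast
    then show "a = 0 \<and> b = 0 \<and> c = 0 \<and> d = 0" using f by (metis UNIV_I)
  qed
next
  assume *: "\<forall>a b c d. lincomb x a b c d = 0 \<longrightarrow> a = 0 \<and> b = 0 \<and> c = 0 \<and> d = 0"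
  show "indep_rows UNIV x"
    unfolding indep_rows_def
  proof (intro allI impI)
    fix f assume "(\<Sum>i\<in>UNIV. f i *s x $ i) = 0"
    then have "lincomb x (f k0) (f k1) (f k2) (f k3) = 0" by (simp add: sum_rows lincomb_def)
    then have "f k0 = 0 \<and> f k1 = 0 \<and> f k2 = 0 \<and> f k3 = 0" using * by blast
    then show "\<forall>i\<in>UNIV. f i = 0" by (auto simp: all_rows)
  qed
qed

lemma lincomb_eq_0_iff:
  assumes "indep_rows UNIV x"
  shows "lincomb x a b c d = 0 \<longleftrightarrow> a = 0 \<and> b = 0 \<and> c = 0 \<and> d = 0"
  using assms unfolding indep_rows_iff_lincomb by (auto simp: lincomb_def)

lemma lincomb_eq_iff:
  assumes "indep_rows UNIV x"
  shows "lincomb x a b c d = lincomb x a' b' c' d' \<longleftrightarrow> a = a' \<and> b = b' \<and> c = c' \<and> d = d'"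
proof -
  have "lincomb x a b c d = lincomb x a' b' c' d' \<longleftrightarrow> lincomb x (a - a') (b - b') (c - c') (d - d') = 0"
    by (simp flip: lincomb_diff)
  then show ?thesis by (simp add: lincomb_eq_0_iff[OF assms])
qed

definition desargues :: "complex ^ 'n ^ 'k \<Rightarrow> 'n::finite six_points" where
  "desargues x = (proj_point (x $ k1), proj_point (x $ k1 + x $ k0),
                  proj_point (x $ k2), proj_point (x $ k2 + x $ k0),
                  proj_point (x $ k3), proj_point (x $ k3 + x $ k0))"

text \<open>
  In coordinates with respect to the frame all incidences become comparisons of coefficients; the
  three lines meet in the point of the row \<open>k0\<close>.
\<close>

lemma desargues_nonplanar:
  fixes x :: "complex ^ 'n ^ 'k"
  assumes x: "indep_rows UNIV x"
  shows "desargues x \<in> nonplanar_desargues"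
proof -
  let ?p = "\<lambda>a b c d. proj_point (lincomb x a b c d)"
  note eq = lincomb_eq_iff[OF x] and z = lincomb_eq_0_iff[OF x]
  have peq: "?p a b c d = ?p a' b' c' d' \<longleftrightarrow>
      (\<exists>s. s \<noteq> 0 \<and> a' = s * a \<and> b' = s * b \<and> c' = s * c \<and> d' = s * d)"
    if "(a, b, c, d) \<noteq> (0, 0, 0, 0)" "(a', b', c', d') \<noteq> (0, 0, 0, 0)" for a b c d a' b' c' d'
    using that z by (subst proj_point_eq_iff) (auto simp: lincomb_scale eq)
  let ?v = "{lincomb x 0 1 0 0, lincomb x 1 1 0 0, lincomb x 0 0 1 0, lincomb x 1 0 1 0, lincomb x 0 0 0 1, lincomb x 1 0 0 1}"
  have d: "desargues x = (?p 0 1 0 0, ?p 1 1 0 0, ?p 0 0 1 0, ?p 1 0 1 0, ?p 0 0 0 1, ?p 1 0 0 1)"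
    unfolding desargues_def row_lincomb lincomb_add by simp
  have 1: "distinct [?p 0 1 0 0, ?p 1 1 0 0, ?p 0 0 1 0, ?p 1 0 1 0, ?p 0 0 0 1, ?p 1 0 0 1]"
    by (simp add: peq)
  have L: "proj_point u \<in> proj_line (?p a b c d) (?p a' b' c' d') \<longleftrightarrow>
      (\<exists>s t. u = lincomb x (s * a + t * a') (s * b + t * b') (s * c + t * c') (s * d + t * d'))"
    if "(a, b, c, d) \<noteq> (0, 0, 0, 0)" "(a', b', c', d') \<noteq> (0, 0, 0, 0)" "u \<noteq> 0" for u a b c d a' b' c' d'
    using that z by (subst proj_point_in_line_iff) (auto simp: lincomb_scale lincomb_add)
  let ?J = "proj_line (?p 0 1 0 0) (?p 1 1 0 0) \<inter> proj_line (?p 0 0 1 0) (?p 1 0 1 0) \<inter>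
      proj_line (?p 0 0 0 1) (?p 1 0 0 1)"
  have J: "?J = {?p 1 0 0 0}"
  proof (rule Set.set_eqI)
    fix P :: "'n cproj"
    obtain u where u: "u \<noteq> 0" "P = proj_point u" by (rule proj_point_cases)
    have "P \<in> ?J \<longleftrightarrow> (\<exists>s t. u = lincomb x t (s + t) 0 0) \<and> (\<exists>s t. u = lincomb x t 0 (s + t) 0) \<and>
        (\<exists>s t. u = lincomb x t 0 0 (s + t))"
      using u by (simp add: L)
    also have "\<dots> \<longleftrightarrow> (\<exists>s. u = lincomb x s 0 0 0)"
    proof
      assume "(\<exists>s t. u = lincomb x t (s + t) 0 0) \<and> (\<exists>s t. u = lincomb x t 0 (s + t) 0) \<and>
        (\<exists>s t. u = lincomb x t 0 0 (s + t))"
      then obtain s t s' t' where "u = lincomb x t (s + t) 0 0" "u = lincomb x t' 0 (s' + t') 0" by blast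
      then show "\<exists>s. u = lincomb x s 0 0 0" by (auto simp: eq)
    next
      assume "\<exists>s. u = lincomb x s 0 0 0"
      then obtain s where "u = lincomb x s 0 0 0" by blast
      then have "u = lincomb x s (- s + s) 0 0" "u = lincomb x s 0 (- s + s) 0" "u = lincomb x s 0 0 (- s + s)"
        by simp_all
      then show "(\<exists>s t. u = lincomb x t (s + t) 0 0) \<and> (\<exists>s t. u = lincomb x t 0 (s + t) 0) \<and>
        (\<exists>s t. u = lincomb x t 0 0 (s + t))" by blast
    qed
    also have "\<dots> \<longleftrightarrow> (\<exists>s. s \<noteq> 0 \<and> u = s *s lincomb x 1 0 0 0)"
      using u by (auto simp: lincomb_scale lincomb_def)
    also have "\<dots> \<longleftrightarrow> P = ?p 1 0 0 0"
      using u z proj_point_eq_iff[of "lincomb x 1 0 0 0" u] by auto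
    finally show "P \<in> ?J \<longleftrightarrow> P \<in> {?p 1 0 0 0}" by simp
  qed
  have "vec.span ?v = vec.span (range (($) x))"
  proof (subst vec.span_eq, intro conjI subsetI)
    have c: "lincomb x a b c d \<in> vec.span (range (($) x))" for a b c d
      unfolding lincomb_def by (intro vec.span_add vec.span_scale vec.span_base) auto
    show "v \<in> vec.span (range (($) x))" if "v \<in> ?v" for v
      using that c by auto
    show "v \<in> vec.span ?v" if v: "v \<in> range (($) x)" for v
    proof -
      have "x $ k1 \<in> vec.span ?v" "x $ k2 \<in> vec.span ?v" "x $ k3 \<in> vec.span ?v"
        unfolding row_lincomb by (auto intro: vec.span_base)
      moreover have "x $ k0 = lincomb x 1 1 0 0 - lincomb x 0 1 0 0"
        unfolding lincomb_diff row_lincomb by simp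
      moreover have "lincomb x 1 1 0 0 - lincomb x 0 1 0 0 \<in> vec.span ?v"
        by (intro vec.span_diff vec.span_base) auto
      moreover have "v \<in> {x $ k0, x $ k1, x $ k2, x $ k3}"
        using v unfolding all_rows by auto
      ultimately show ?thesis by (elim insertE) (simp_all only: empty_iff)
    qed
  qed
  then have "vec.dim (vec.span ?v) = 4"
    using x card_rows by (simp add: indep_rows_iff_dim)
  moreover have "proj_span (proj_point ` ?v) = {P. line_of P \<subseteq> vec.span ?v}"
    using z by (intro proj_span_proj_points) auto
  ultimately have 2: "proj_subspace 3 (proj_span {?p 0 1 0 0, ?p 1 1 0 0, ?p 0 0 1 0, ?p 1 0 1 0, ?p 0 0 0 1, ?p 1 0 0 1})"
    unfolding proj_subspace_def
    by (intro exI[of _ "vec.span ?v"]) (simp del: vec.dim_span add: vec.subspace_span)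
  have 3: "{?p 0 1 0 0, ?p 1 1 0 0} \<subseteq> proj_line (?p 0 1 0 0) (?p 1 1 0 0) - ?J"
    "{?p 0 0 1 0, ?p 1 0 1 0} \<subseteq> proj_line (?p 0 0 1 0) (?p 1 0 1 0) - ?J"
    "{?p 0 0 0 1, ?p 1 0 0 1} \<subseteq> proj_line (?p 0 0 0 1) (?p 1 0 0 1) - ?J"
  proof -
    have i: "P \<in> proj_line P Q" "Q \<in> proj_line P Q" for P Q :: "'n cproj"
      unfolding proj_span_def by (auto intro: vec.span_base)
    show "{?p 0 1 0 0, ?p 1 1 0 0} \<subseteq> proj_line (?p 0 1 0 0) (?p 1 1 0 0) - ?J"
      "{?p 0 0 1 0, ?p 1 0 1 0} \<subseteq> proj_line (?p 0 0 1 0) (?p 1 0 1 0) - ?J"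
      "{?p 0 0 0 1, ?p 1 0 0 1} \<subseteq> proj_line (?p 0 0 0 1) (?p 1 0 0 1) - ?J"
      unfolding J by (auto simp: i peq)
  qed
  show ?thesis
    unfolding d nonplanar_desargues_def mem_Collect_eq case_prod_conv Let_def
    using 1 2 3 J by blast
qed

text \<open>
  If \<open>v\<close> represents the common point, then \<open>v = s a\<^sub>i + t b\<^sub>i\<close> on each line, with both coefficients nonzero
  since neither point is the common one. So \<open>e\<^sub>i = - s a\<^sub>i\<close> has the property that \<open>e\<^sub>i + v\<close> represents \<open>B\<^sub>i\<close>.
  Independence of the four vectors is the dimension condition.
\<close>

lemma nonplanar_desarguesE:
  fixes d :: "'n::finite six_points"
  assumes "d \<in> nonplanar_desargues"
  obtains x :: "complex ^ 'n ^ 'k" where "indep_rows UNIV x" "desargues x = d"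
proof -
  obtain A1 B1 A2 B2 A3 B3 where d: "d = (A1, B1, A2, B2, A3, B3)" by (cases d)
  let ?J = "proj_line A1 B1 \<inter> proj_line A2 B2 \<inter> proj_line A3 B3"
  have sub: "proj_subspace 3 (proj_span {A1, B1, A2, B2, A3, B3})"
    and "\<exists>I. ?J = {I}"
    and notJ: "A1 \<notin> ?J" "B1 \<notin> ?J" "A2 \<notin> ?J" "B2 \<notin> ?J" "A3 \<notin> ?J" "B3 \<notin> ?J"
    using assms unfolding d nonplanar_desargues_def mem_Collect_eq case_prod_conv Let_def by blast+
  then obtain I where J: "?J = {I}" by blast
  obtain v where v: "v \<noteq> 0" "I = proj_point v" by (rule proj_point_cases)
  have repr: "\<exists>e. e \<noteq> 0 \<and> e + v \<noteq> 0 \<and> A = proj_point e \<and> B = proj_point (e + v)"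
    if I: "I \<in> proj_line A B" "A \<noteq> I" "B \<noteq> I" for A B
  proof -
    obtain a where a: "a \<noteq> 0" "A = proj_point a" by (rule proj_point_cases)
    obtain b where b: "b \<noteq> 0" "B = proj_point b" by (rule proj_point_cases)
    obtain s t where st: "v = s *s a + t *s b"
      using I(1) a b v by (auto simp: proj_point_in_line_iff)
    have "t \<noteq> 0"
    proof
      assume "t = 0"
      then have "v = s *s a" "s \<noteq> 0" using st v by auto
      then show False using I(2) a v proj_point_eq_iff[of a v] by auto
    qed
    have "s \<noteq> 0"
    proof
      assume "s = 0"
      then have "v = t *s b" "t \<noteq> 0" using st v by auto
      then show False using I(3) b v proj_point_eq_iff[of b v] by auto
    qed
    have 1: "(- s) *s a \<noteq> 0" using \<open>s \<noteq> 0\<close> a by simp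
    moreover have 2: "(- s) *s a + v = t *s b" by (simp add: st vec_eq_iff)
    moreover have 3: "t *s b \<noteq> 0" using \<open>t \<noteq> 0\<close> b by simp
    moreover have "A = proj_point ((- s) *s a)"
      using a 1 \<open>s \<noteq> 0\<close> by (simp only: proj_point_eq_iff a) (metis neg_equal_0_iff_equal)
    moreover have "B = proj_point ((- s) *s a + v)"
      using b 3 \<open>t \<noteq> 0\<close> unfolding 2 by (simp only: proj_point_eq_iff b) blast
    ultimately show ?thesis by metis
  qed
  have IJ: "I \<in> proj_line A1 B1" "I \<in> proj_line A2 B2" "I \<in> proj_line A3 B3" using J by auto
  have ne: "A1 \<noteq> I" "B1 \<noteq> I" "A2 \<noteq> I" "B2 \<noteq> I" "A3 \<noteq> I" "B3 \<noteq> I" using notJ unfolding J by auto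
  obtain e1 e2 e3 where
    e1: "e1 \<noteq> 0" "e1 + v \<noteq> 0" "A1 = proj_point e1" "B1 = proj_point (e1 + v)" and
    e2: "e2 \<noteq> 0" "e2 + v \<noteq> 0" "A2 = proj_point e2" "B2 = proj_point (e2 + v)" and
    e3: "e3 \<noteq> 0" "e3 + v \<noteq> 0" "A3 = proj_point e3" "B3 = proj_point (e3 + v)"
    using repr[OF IJ(1) ne(1,2)] repr[OF IJ(2) ne(3,4)] repr[OF IJ(3) ne(5,6)] by blast
  define x where "x = (\<chi> i. if i = k0 then v else if i = k1 then e1 else if i = k2 then e2 else e3)"
  have x: "x $ k0 = v" "x $ k1 = e1" "x $ k2 = e2" "x $ k3 = e3"
    using distinct_rows by (auto simp: x_def)
  let ?v = "{e1, e1 + v, e2, e2 + v, e3, e3 + v}"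
  have span: "vec.span ?v = vec.span (range (($) x))"
  proof (subst vec.span_eq, intro conjI subsetI)
    have R: "v \<in> vec.span (range (($) x))" "e1 \<in> vec.span (range (($) x))"
        "e2 \<in> vec.span (range (($) x))" "e3 \<in> vec.span (range (($) x))"
      using x by (metis rangeI vec.span_base)+
    show "w \<in> vec.span (range (($) x))" if "w \<in> ?v" for w
      using that R by (auto intro: vec.span_add)
    show "w \<in> vec.span ?v" if w: "w \<in> range (($) x)" for w
    proof -
      have "(e1 + v) - e1 \<in> vec.span ?v" by (intro vec.span_diff vec.span_base) auto
      then have "v \<in> vec.span ?v" by simp
      moreover have "w \<in> {v, e1, e2, e3}"
        using w x unfolding all_rows by auto
      ultimately show ?thesis by (auto intro: vec.span_base)
    qed
  qed
  have ps: "proj_span {A1, B1, A2, B2, A3, B3} = {P. line_of P \<subseteq> vec.span ?v}"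
    using proj_span_proj_points[of ?v] e1 e2 e3 by auto
  obtain W :: "(complex ^ 'n) set" where W: "vec.subspace W" "vec.dim W = 4"
    "{P. line_of P \<subseteq> vec.span ?v} = {P. line_of P \<subseteq> W}"
    using sub unfolding ps proj_subspace_def by auto
  have W_eq: "vec.span S = vec.span ?v" if S: "vec.subspace S" "{P. line_of P \<subseteq> vec.span ?v} = {P. line_of P \<subseteq> S}" for S
  proof -
    have m: "w \<in> T \<longleftrightarrow> proj_point w \<in> {P. line_of P \<subseteq> T}" if "vec.subspace T" "w \<noteq> 0" for w T
      using that by (simp add: line_of_proj_point) (metis insert_subset singletonI vec.span_base vec.span_minimal empty_subsetI subsetD)
    have "w \<in> S \<longleftrightarrow> w \<in> vec.span ?v" for w
    proof (cases "w = 0")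
      case True then show ?thesis using S(1) by (simp add: vec.subspace_0 vec.span_zero)
    next
      case False
      show ?thesis unfolding m[OF S(1) False] m[OF vec.subspace_span False] S(2) ..
    qed
    then have "S = vec.span ?v" by blast
    then show ?thesis by (simp add: vec.span_span)
  qed
  have "vec.dim (range (($) x)) = vec.dim W"
    using W_eq[OF W(1,3)] span by (metis vec.dim_span)
  then have "indep_rows UNIV x"
    using W(2) card_rows by (simp add: indep_rows_iff_dim)
  moreover have "desargues x = d"
    by (simp add: desargues_def x d e1 e2 e3)
  ultimately show ?thesis using that by blast
qed

lemma row_nonzero:
  assumes "indep_rows UNIV x"
  shows "x $ k1 \<noteq> 0" "x $ k2 \<noteq> 0" "x $ k3 \<noteq> 0"
    "x $ k1 + x $ k0 \<noteq> 0" "x $ k2 + x $ k0 \<noteq> 0" "x $ k3 + x $ k0 \<noteq> 0"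
  unfolding row_lincomb lincomb_add by (simp_all add: lincomb_eq_0_iff[OF assms])

lemma desargues_cscale: "\<mu> \<noteq> 0 \<Longrightarrow> desargues (cscale \<mu> x) = desargues x"
  by (simp add: desargues_def proj_point_scale flip: vector_add_ldistrib)

text \<open>
  The points determine each \<open>e\<^sub>i\<close> and each \<open>e\<^sub>i + v\<close> up to its own factor. Writing \<open>v\<close> in terms of the other
  frame along all three lines forces these factors to agree.
\<close>

lemma desargues_eq_iff:
  assumes x: "indep_rows UNIV x" and y: "indep_rows UNIV y"
  shows "desargues x = desargues y \<longleftrightarrow> (\<exists>\<mu>. \<mu> \<noteq> 0 \<and> y = cscale \<mu> x)"
proof
  assume "desargues x = desargues y"
  then obtain m1 m2 m3 n1 n2 n3 where
    m: "y $ k1 = m1 *s x $ k1" "y $ k2 = m2 *s x $ k2" "y $ k3 = m3 *s x $ k3" "m1 \<noteq> 0" and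
    n: "y $ k1 + y $ k0 = n1 *s (x $ k1 + x $ k0)" "y $ k2 + y $ k0 = n2 *s (x $ k2 + x $ k0)"
       "y $ k3 + y $ k0 = n3 *s (x $ k3 + x $ k0)"
    unfolding desargues_def
    by (auto simp: proj_point_eq_iff row_nonzero[OF x] row_nonzero[OF y])
  have "y $ k0 = lincomb x n1 (n1 - m1) 0 0"
    using n(1) unfolding m by (simp add: lincomb_def vec_eq_iff algebra_simps)
  moreover have "y $ k0 = lincomb x n2 0 (n2 - m2) 0"
    using n(2) unfolding m by (simp add: lincomb_def vec_eq_iff algebra_simps)
  moreover have "y $ k0 = lincomb x n3 0 0 (n3 - m3)"
    using n(3) unfolding m by (simp add: lincomb_def vec_eq_iff algebra_simps)
  ultimately have e: "n1 = m1" "m2 = m1" "m3 = m1" "y $ k0 = lincomb x n1 (n1 - m1) 0 0"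
    by (auto simp: lincomb_eq_iff[OF x])
  then have "y $ k0 = m1 *s x $ k0" by (simp add: lincomb_def)
  then have "y $ i = m1 *s x $ i" for i
    using m e UNIV_I[of i] unfolding all_rows by auto
  then have "y = cscale m1 x" by (simp add: vec_eq_iff)
  then show "\<exists>\<mu>. \<mu> \<noteq> 0 \<and> y = cscale \<mu> x" using m by blast
next
  assume "\<exists>\<mu>. \<mu> \<noteq> 0 \<and> y = cscale \<mu> x"
  then obtain \<mu> where \<mu>: "\<mu> \<noteq> 0" "y = cscale \<mu> x" by blast
  then show "desargues x = desargues y" by (simp add: desargues_cscale)
qed

end

section \<open>Lifting configurations to frames\<close>

context four_rows
begin

definition rows4 :: "'a \<Rightarrow> 'a \<Rightarrow> 'a \<Rightarrow> 'a \<Rightarrow> 'a ^ 'k" where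
  "rows4 p q r s = (\<chi> i. if i = k0 then p else if i = k1 then q else if i = k2 then r else s)"

lemma rows4_nth [simp]:
  "rows4 p q r s $ k0 = p" "rows4 p q r s $ k1 = q" "rows4 p q r s $ k2 = r" "rows4 p q r s $ k3 = s"
  using distinct_rows by (auto simp: rows4_def)

lemma rows4_eqI:
  assumes "x $ k0 = p" "x $ k1 = q" "x $ k2 = r" "x $ k3 = s"
  shows "rows4 p q r s = x"
  unfolding vec_eq_iff
proof
  fix i
  have "i \<in> {k0, k1, k2, k3}" using all_rows by blast
  then show "rows4 p q r s $ i = x $ i" using assms by auto
qed

lemma lincomb_rows4: "lincomb (rows4 u v w z) p q r s = p *s u + q *s v + r *s w + s *s z"
  by (simp add: lincomb_def)

lemma continuous_on_rows4:
  assumes "continuous_on S p" "continuous_on S q" "continuous_on S r" "continuous_on S s"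
  shows "continuous_on S (\<lambda>t. rows4 (p t) (q t) (r t) (s t))"
  unfolding rows4_def
proof (rule continuous_on_vec_lambda)
  fix i
  show "continuous_on S (\<lambda>t. if i = k0 then p t else if i = k1 then q t else if i = k2 then r t else s t)"
    using assms by (cases "i = k0"; cases "i = k1"; cases "i = k2") auto
qed

text \<open>
  A continuous choice of representatives \<open>a\<^sub>i, b\<^sub>i\<close> of the six points yields a continuous frame. Take
  \<open>b\<^sub>1, a\<^sub>1, a\<^sub>2, a\<^sub>3\<close> as a moving basis. Concurrency of the lines says that
  \<open>b\<^sub>2 = c\<^sub>0 b\<^sub>1 + c\<^sub>1 a\<^sub>1 + c\<^sub>2 a\<^sub>2\<close> with \<open>c\<^sub>0 \<noteq> 0\<close>, so that the common point of the lines is represented by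
  \<open>v = b\<^sub>1 + (c\<^sub>1 / c\<^sub>0) a\<^sub>1\<close>, and \<open>b\<^sub>2 / c\<^sub>0 - v\<close> is the multiple of \<open>a\<^sub>2\<close> needed in the frame; likewise for the
  third line with \<open>b\<^sub>3\<close>. The coefficients are continuous by \<open>continuous_on_coefficients\<close>.
\<close>

lemma continuous_frame_of_representatives:
  fixes S :: "'a::topological_space set" and a1 b1 a2 b2 a3 b3 :: "'a \<Rightarrow> complex ^ 'n"
  assumes cont: "continuous_on S a1" "continuous_on S b1" "continuous_on S a2" "continuous_on S b2"
      "continuous_on S a3" "continuous_on S b3"
    and nz: "\<And>t. t \<in> S \<Longrightarrow> a1 t \<noteq> 0 \<and> b1 t \<noteq> 0 \<and> a2 t \<noteq> 0 \<and> b2 t \<noteq> 0 \<and> a3 t \<noteq> 0 \<and> b3 t \<noteq> 0"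
    and D: "\<And>t. t \<in> S \<Longrightarrow> (proj_point (a1 t), proj_point (b1 t), proj_point (a2 t),
      proj_point (b2 t), proj_point (a3 t), proj_point (b3 t)) \<in> nonplanar_desargues"
  obtains f :: "'a \<Rightarrow> complex ^ 'n ^ 'k" where "continuous_on S f"
    "\<And>t. t \<in> S \<Longrightarrow> indep_rows UNIV (f t) \<and> desargues (f t) = (proj_point (a1 t),
      proj_point (b1 t), proj_point (a2 t), proj_point (b2 t), proj_point (a3 t), proj_point (b3 t))"
proof -
  let ?d = "\<lambda>t. (proj_point (a1 t), proj_point (b1 t), proj_point (a2 t), proj_point (b2 t),
      proj_point (a3 t), proj_point (b3 t))"
  define Y where "Y t = rows4 (b1 t) (a1 t) (a2 t) (a3 t)" for t
  define v where "v t c = b1 t + (c $ k1 / c $ k0) *s a1 t" for t and c :: "complex ^ 'k"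
  define F where "F t c c' = rows4 (v t c) (b1 t - v t c) (inverse (c $ k0) *s b2 t - v t c)
      (inverse (c' $ k0) *s b3 t - v t c)" for t and c c' :: "complex ^ 'k"
  have "\<exists>c c'. indep_rows UNIV (Y t) \<and> b2 t = (\<Sum>i\<in>UNIV. c $ i *s Y t $ i) \<and>
      b3 t = (\<Sum>i\<in>UNIV. c' $ i *s Y t $ i) \<and> c $ k0 \<noteq> 0 \<and> c' $ k0 \<noteq> 0 \<and>
      indep_rows UNIV (F t c c') \<and> desargues (F t c c') = ?d t"
    if t: "t \<in> S" for t
  proof -
    obtain x :: "complex ^ 'n ^ 'k" where x: "indep_rows UNIV x" "desargues x = ?d t"
      using nonplanar_desarguesE[OF D[OF t]] by blast
    have sc: "\<exists>c. c \<noteq> 0 \<and> w = c *s u" if "proj_point u = proj_point w" "u \<noteq> 0" "w \<noteq> 0"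
      for u w :: "complex ^ 'n" using that by (simp add: proj_point_eq_iff)
    obtain l1 l2 l3 m1 m2 m3 where
      a: "a1 t = l1 *s x $ k1" "a2 t = l2 *s x $ k2" "a3 t = l3 *s x $ k3" and
      b: "b1 t = m1 *s (x $ k1 + x $ k0)" "b2 t = m2 *s (x $ k2 + x $ k0)"
         "b3 t = m3 *s (x $ k3 + x $ k0)" and
      lm: "l1 \<noteq> 0" "l2 \<noteq> 0" "l3 \<noteq> 0" "m1 \<noteq> 0" "m2 \<noteq> 0" "m3 \<noteq> 0"
      using x(2) nz[OF t] row_nonzero[OF x(1)] sc unfolding desargues_def prod.inject by metis
    (* These are b2 = (m2/m1) b1 - (m2/l1) a1 + (m2/l2) a2 and its analogue for b3. *)
    let ?c = "rows4 (m2 / m1) (- m2 / l1) (m2 / l2) 0"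
    let ?c' = "rows4 (m3 / m1) (- m3 / l1) 0 (m3 / l3)"
    have ab: "a1 t = lincomb x 0 l1 0 0" "a2 t = lincomb x 0 0 l2 0" "a3 t = lincomb x 0 0 0 l3"
      "b1 t = lincomb x m1 m1 0 0" "b2 t = lincomb x m2 0 m2 0" "b3 t = lincomb x m3 0 0 m3"
      unfolding a b row_lincomb lincomb_add lincomb_scale by simp_all
    have "lincomb (Y t) p q r s = lincomb x (p * m1) (p * m1 + q * l1) (r * l2) (s * l3)" for p q r s
      by (simp add: lincomb_rows4 Y_def ab lincomb_simps)
    then have "indep_rows UNIV (Y t)"
      using lm unfolding indep_rows_iff_lincomb by (auto simp: lincomb_eq_0_iff[OF x(1)])
    moreover have "b2 t = (\<Sum>i\<in>UNIV. ?c $ i *s Y t $ i)" "b3 t = (\<Sum>i\<in>UNIV. ?c' $ i *s Y t $ i)"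
      using lm by (simp_all add: sum_rows Y_def ab lincomb_simps)
    moreover have "F t ?c ?c' = cscale m1 x"
    proof -
      have v: "v t ?c = lincomb x m1 0 0 0"
        using lm by (simp add: v_def ab lincomb_simps)
      show ?thesis
        unfolding F_def v ab
        by (rule rows4_eqI) (use lm in \<open>simp_all add: lincomb_simps row_lincomb[of x]\<close>)
    qed
    ultimately show ?thesis
      using lm x by (intro exI[of _ ?c] exI[of _ ?c']) (simp add: indep_rows_cscale desargues_cscale)
  qed
  then have "\<forall>t\<in>S. \<exists>z. indep_rows UNIV (Y t) \<and> b2 t = (\<Sum>i\<in>UNIV. fst z $ i *s Y t $ i) \<and>
      b3 t = (\<Sum>i\<in>UNIV. snd z $ i *s Y t $ i) \<and> fst z $ k0 \<noteq> 0 \<and> snd z $ k0 \<noteq> 0 \<and>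
      indep_rows UNIV (F t (fst z) (snd z)) \<and> desargues (F t (fst z) (snd z)) = ?d t"
    by simp
  from bchoice[OF this] obtain z where z: "\<And>t. t \<in> S \<Longrightarrow> indep_rows UNIV (Y t) \<and>
      b2 t = (\<Sum>i\<in>UNIV. fst (z t) $ i *s Y t $ i) \<and>
      b3 t = (\<Sum>i\<in>UNIV. snd (z t) $ i *s Y t $ i) \<and> fst (z t) $ k0 \<noteq> 0 \<and> snd (z t) $ k0 \<noteq> 0 \<and>
      indep_rows UNIV (F t (fst (z t)) (snd (z t))) \<and>
      desargues (F t (fst (z t)) (snd (z t))) = ?d t"
    by blast
  have Y: "continuous_on S Y" unfolding Y_def by (intro continuous_on_rows4 cont)
  have c: "continuous_on S (\<lambda>t. fst (z t))" "continuous_on S (\<lambda>t. snd (z t))"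
    by (rule continuous_on_coefficients[OF Y cont(4)], use z in blast, use z in blast)
       (rule continuous_on_coefficients[OF Y cont(6)], use z in blast, use z in blast)
  have v: "continuous_on S (\<lambda>t. v t (fst (z t)))"
    unfolding v_def by (intro continuous_intros c cont) (use z in blast)
  have "continuous_on S (\<lambda>t. F t (fst (z t)) (snd (z t)))"
    unfolding F_def by (intro continuous_on_rows4 continuous_intros v c cont) (use z in blast)+
  then show ?thesis using that z by blast
qed

lemma desargues_local_section:
  fixes d :: "'n::finite six_points"
  obtains U and f :: "'n six_points \<Rightarrow> complex ^ 'n ^ 'k" where "open U" "d \<in> U"
    "continuous_on (U \<inter> nonplanar_desargues) f"
    "\<And>e. e \<in> U \<inter> nonplanar_desargues \<Longrightarrow> indep_rows UNIV (f e) \<and> desargues (f e) = e"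
proof -
  obtain A1 B1 A2 B2 A3 B3 where d: "d = (A1, B1, A2, B2, A3, B3)" by (cases d)
  have *: "\<exists>U \<sigma>. open U \<and> P \<in> U \<and> continuous_on U \<sigma> \<and> (\<forall>Q\<in>U. \<sigma> Q \<noteq> 0 \<and> proj_point (\<sigma> Q) = Q)"
    for P :: "'n cproj"
    using proj_point_local_section[of P] by metis
  obtain U1 \<sigma>1 where 1: "open U1" "A1 \<in> U1" "continuous_on U1 \<sigma>1" "\<forall>Q\<in>U1. \<sigma>1 Q \<noteq> 0 \<and> proj_point (\<sigma>1 Q) = Q"
    using *[of A1] by blast
  obtain V1 \<tau>1 where 2: "open V1" "B1 \<in> V1" "continuous_on V1 \<tau>1" "\<forall>Q\<in>V1. \<tau>1 Q \<noteq> 0 \<and> proj_point (\<tau>1 Q) = Q"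
    using *[of B1] by blast
  obtain U2 \<sigma>2 where 3: "open U2" "A2 \<in> U2" "continuous_on U2 \<sigma>2" "\<forall>Q\<in>U2. \<sigma>2 Q \<noteq> 0 \<and> proj_point (\<sigma>2 Q) = Q"
    using *[of A2] by blast
  obtain V2 \<tau>2 where 4: "open V2" "B2 \<in> V2" "continuous_on V2 \<tau>2" "\<forall>Q\<in>V2. \<tau>2 Q \<noteq> 0 \<and> proj_point (\<tau>2 Q) = Q"
    using *[of B2] by blast
  obtain U3 \<sigma>3 where 5: "open U3" "A3 \<in> U3" "continuous_on U3 \<sigma>3" "\<forall>Q\<in>U3. \<sigma>3 Q \<noteq> 0 \<and> proj_point (\<sigma>3 Q) = Q"
    using *[of A3] by blast
  obtain V3 \<tau>3 where 6: "open V3" "B3 \<in> V3" "continuous_on V3 \<tau>3" "\<forall>Q\<in>V3. \<tau>3 Q \<noteq> 0 \<and> proj_point (\<tau>3 Q) = Q"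
    using *[of B3] by blast
  define U where "U = U1 \<times> V1 \<times> U2 \<times> V2 \<times> U3 \<times> V3"
  let ?S = "U \<inter> nonplanar_desargues"
  have oU: "open U" unfolding U_def by (intro open_Times 1 2 3 4 5 6)
  have cont: "continuous_on ?S (\<lambda>e. \<sigma>1 (fst e))" "continuous_on ?S (\<lambda>e. \<tau>1 (fst (snd e)))"
    "continuous_on ?S (\<lambda>e. \<sigma>2 (fst (snd (snd e))))" "continuous_on ?S (\<lambda>e. \<tau>2 (fst (snd (snd (snd e)))))"
    "continuous_on ?S (\<lambda>e. \<sigma>3 (fst (snd (snd (snd (snd e))))))"
    "continuous_on ?S (\<lambda>e. \<tau>3 (snd (snd (snd (snd (snd e))))))"
         apply (rule continuous_on_compose2[OF 1(3)]; (intro continuous_intros)?; force simp: U_def)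
        apply (rule continuous_on_compose2[OF 2(3)]; (intro continuous_intros)?; force simp: U_def)
       apply (rule continuous_on_compose2[OF 3(3)]; (intro continuous_intros)?; force simp: U_def)
      apply (rule continuous_on_compose2[OF 4(3)]; (intro continuous_intros)?; force simp: U_def)
     apply (rule continuous_on_compose2[OF 5(3)]; (intro continuous_intros)?; force simp: U_def)
    apply (rule continuous_on_compose2[OF 6(3)]; (intro continuous_intros)?; force simp: U_def)
    done
  have nz: "\<sigma>1 (fst e) \<noteq> 0 \<and> \<tau>1 (fst (snd e)) \<noteq> 0 \<and> \<sigma>2 (fst (snd (snd e))) \<noteq> 0 \<and>
      \<tau>2 (fst (snd (snd (snd e)))) \<noteq> 0 \<and> \<sigma>3 (fst (snd (snd (snd (snd e))))) \<noteq> 0 \<and>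
      \<tau>3 (snd (snd (snd (snd (snd e))))) \<noteq> 0"
    and eq: "(proj_point (\<sigma>1 (fst e)), proj_point (\<tau>1 (fst (snd e))), proj_point (\<sigma>2 (fst (snd (snd e)))),
      proj_point (\<tau>2 (fst (snd (snd (snd e))))), proj_point (\<sigma>3 (fst (snd (snd (snd (snd e)))))),
      proj_point (\<tau>3 (snd (snd (snd (snd (snd e))))))) = e" if "e \<in> ?S" for e
    using that 1(4) 2(4) 3(4) 4(4) 5(4) 6(4) by (auto simp: U_def)
  obtain f :: "'n six_points \<Rightarrow> complex ^ 'n ^ 'k" where f: "continuous_on ?S f"
    "\<And>e. e \<in> ?S \<Longrightarrow> indep_rows UNIV (f e) \<and> desargues (f e) =
      (proj_point (\<sigma>1 (fst e)), proj_point (\<tau>1 (fst (snd e))), proj_point (\<sigma>2 (fst (snd (snd e)))),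
      proj_point (\<tau>2 (fst (snd (snd (snd e))))), proj_point (\<sigma>3 (fst (snd (snd (snd (snd e)))))),
      proj_point (\<tau>3 (snd (snd (snd (snd (snd e)))))))"
    using continuous_frame_of_representatives[OF cont nz] eq by (metis (no_types, lifting) IntD2)
  have "indep_rows UNIV (f e) \<and> desargues (f e) = e" if "e \<in> ?S" for e
    using f(2)[OF that] unfolding eq[OF that] .
  moreover have "d \<in> U" using 1 2 3 4 5 6 by (simp add: U_def d)
  ultimately show ?thesis using that oU f(1) by blast
qed

lemma continuous_on_desargues: "continuous_on {x :: complex ^ 'n ^ 'k. indep_rows UNIV x} desargues"
proof -
  have *: "continuous_on {x :: complex ^ 'n ^ 'k. indep_rows UNIV x} (\<lambda>x. proj_point (h x))"
    if "continuous_on {x. indep_rows UNIV x} h" "\<And>x. indep_rows UNIV x \<Longrightarrow> h x \<noteq> 0"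
    for h :: "complex ^ 'n ^ 'k \<Rightarrow> complex ^ 'n"
    by (rule continuous_on_compose2[OF continuous_on_proj_point that(1)]) (use that(2) in auto)
  show ?thesis
    unfolding desargues_def
    by (intro continuous_on_Pair * continuous_intros) (simp_all add: row_nonzero)
qed

text \<open>
  On short intervals a lift is a local section composed with the path, multiplied by the constant
  scalar that gives it the prescribed initial value. Because the initial value can be prescribed,
  lifts over adjacent intervals fit together, and Bolzano's bisection principle applies.
\<close>

lemma desargues_path_lift:
  fixes x :: "complex ^ 'n ^ 'k"
  assumes p: "path p" "path_image p \<subseteq> nonplanar_desargues"
    and x: "indep_rows UNIV x" "desargues x = pathstart p"
  obtains g where "path g" "path_image g \<subseteq> {x. indep_rows UNIV x}" "pathstart g = x"
    "\<And>t. t \<in> {0..1} \<Longrightarrow> desargues (g t) = p t"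
proof -
  define lifts where "lifts a b g \<longleftrightarrow> continuous_on {a..b} g \<and>
      (\<forall>t\<in>{a..b}. indep_rows UNIV (g t) \<and> desargues (g t) = p t)" for a b and g :: "real \<Rightarrow> complex ^ 'n ^ 'k"
  define P where "P a b \<longleftrightarrow> (0 \<le> a \<longrightarrow> a \<le> b \<longrightarrow> b \<le> 1 \<longrightarrow> (\<forall>y. indep_rows UNIV y \<longrightarrow> desargues y = p a \<longrightarrow>
      (\<exists>g. lifts a b g \<and> g a = y)))" for a b
  have "P 0 1"
  proof (rule Bolzano)
    fix a b c assume Pab: "P a b" and Pbc: "P b c" and abc: "a \<le> b" "b \<le> c"
    show "P a c"
      unfolding P_def
    proof (intro impI allI)
      fix y :: "complex ^ 'n ^ 'k"
      assume y: "0 \<le> a" "a \<le> c" "c \<le> 1" "indep_rows UNIV y" "desargues y = p a"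
      obtain g where g: "lifts a b g" "g a = y" using Pab y abc unfolding P_def by (meson order_trans)
      have "indep_rows UNIV (g b)" "desargues (g b) = p b"
        using g(1) abc unfolding lifts_def by auto
      then obtain h where h: "lifts b c h" "h b = g b" using Pbc y abc unfolding P_def by (meson order_trans)
      let ?g = "\<lambda>t. if t \<le> b then g t else h t"
      have "continuous_on {a..c} ?g"
      proof (rule continuous_on_cases_le[where h = "\<lambda>t. t"])
        have "{t \<in> {a..c}. t \<le> b} = {a..b}" "{t \<in> {a..c}. b \<le> t} = {b..c}" using abc by auto
        then show "continuous_on {t \<in> {a..c}. t \<le> b} g" "continuous_on {t \<in> {a..c}. b \<le> t} h"
          using g h by (simp_all add: lifts_def)
      qed (use h in auto)
      then have "lifts a c ?g" using g h by (auto simp: lifts_def)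
      moreover have "?g a = y" using g abc by simp
      ultimately show "\<exists>g. lifts a c g \<and> g a = y" by blast
    qed
  next
    fix s :: real assume s: "0 \<le> s" "s \<le> 1"
    obtain U and f :: "'n six_points \<Rightarrow> complex ^ 'n ^ 'k" where U: "open U" "p s \<in> U"
      and f: "continuous_on (U \<inter> nonplanar_desargues) f"
      "\<And>e. e \<in> U \<inter> nonplanar_desargues \<Longrightarrow> indep_rows UNIV (f e) \<and> desargues (f e) = e"
      using desargues_local_section[of "p s"] by blast
    have cp: "continuous_on {0..1} p" using p(1) by (simp add: path_def)
    have "\<exists>A. open A \<and> s \<in> A \<and> (\<forall>t\<in>{0..1}. t \<in> A \<longrightarrow> p t \<in> U)"
      using cp[unfolded continuous_on_topological, rule_format, of s U] U s by simp
    then obtain A where A: "open A" "s \<in> A" "\<And>t. t \<in> {0..1} \<Longrightarrow> t \<in> A \<Longrightarrow> p t \<in> U"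
      by blast
    then obtain d where d: "d > 0" "ball s d \<subseteq> A" by (meson openE)
    show "\<exists>d>0. \<forall>a b. a \<le> s \<and> s \<le> b \<and> b - a < d \<longrightarrow> P a b"
    proof (intro exI[of _ d] conjI d allI impI)
      fix a b assume ab: "a \<le> s \<and> s \<le> b \<and> b - a < d"
      show "P a b"
        unfolding P_def
      proof (intro impI allI)
        fix y :: "complex ^ 'n ^ 'k"
        assume y: "0 \<le> a" "a \<le> b" "b \<le> 1" "indep_rows UNIV y" "desargues y = p a"
        have pU: "p t \<in> U \<inter> nonplanar_desargues" if "t \<in> {a..b}" for t
        proof -
          have "t \<in> ball s d" using that ab by (auto simp: dist_real_def)
          then show ?thesis using A(3)[of t] d that y p(2) by (auto simp: path_image_def)
        qed
        have fa: "indep_rows UNIV (f (p a))" "desargues (f (p a)) = desargues y"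
          using f(2)[OF pU[of a]] y by simp_all
        then obtain \<mu> where \<mu>: "\<mu> \<noteq> 0" "y = cscale \<mu> (f (p a))"
          using desargues_eq_iff[OF fa(1) y(4)] by blast
        have "continuous_on {a..b} p" using cp y by (auto intro: continuous_on_subset)
        then have "continuous_on {a..b} (\<lambda>t. f (p t))"
          by (rule continuous_on_compose2[OF f(1)]) (use pU in blast)
        then have "lifts a b (\<lambda>t. cscale \<mu> (f (p t)))"
          unfolding lifts_def using f(2)[OF pU] \<mu>(1)
          by (auto intro!: continuous_intros simp: indep_rows_cscale desargues_cscale)
        then show "\<exists>g. lifts a b g \<and> g a = y" using \<mu>(2) by blast
      qed
    qed
  qed simp
  then obtain g where "lifts 0 1 g" "g 0 = x"
    using x unfolding P_def pathstart_def by auto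
  then show ?thesis
    using that[of g] unfolding lifts_def path_def path_image_def pathstart_def by auto
qed

end

section \<open>Ambient dimension at least four\<close>

lemma trivial_fundamental_groupI:
  assumes c: "c \<in> X" and null: "\<And>p. p \<in> loops X c \<Longrightarrow> homotopic_paths X p (\<lambda>_. c)"
  shows "trivial_group (fundamental_group X c)"
proof -
  let ?G = "fundamental_group X c"
  have const: "(\<lambda>_. c) \<in> loops X c"
    using c by (auto simp: loops_def path_def path_image_def pathstart_def pathfinish_def)
  have one: "one ?G = loop_class X (\<lambda>_. c)" by (simp add: fundamental_group_def)
  have carrier: "carrier ?G = {one ?G}"
  proof -
    have "loop_class X p = one ?G" if "p \<in> loops X c" for p
      unfolding one by (rule loop_class_cong[OF null[OF that]])
    then have "loop_class X ` loops X c = {one ?G}" using const by blast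
    then show ?thesis by (simp add: fundamental_group_def)
  qed
  have "one ?G \<otimes>\<^bsub>?G\<^esub> one ?G = loop_class X ((\<lambda>_. c) +++ (\<lambda>_. c))"
    unfolding one by (rule mult_loop_class[OF const const])
  also have "(\<lambda>_. c) +++ (\<lambda>_. c) = (\<lambda>_. c)" by (auto simp: joinpaths_def)
  finally have "one ?G \<otimes>\<^bsub>?G\<^esub> one ?G = one ?G" by (simp add: one)
  then have "group ?G" by (intro groupI) (auto simp: carrier)
  then show ?thesis using carrier by (simp add: trivial_group_def)
qed

text \<open>
  The lift of a loop runs from a frame \<open>x\<close> to \<open>\<mu> x\<close>. So does the path \<open>exp (t w) x\<close> with \<open>exp w = \<mu>\<close>, which
  lies over a single configuration; the two are homotopic since the frame space is simply connected.
\<close>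

theorem (in four_rows) trivial_fundamental_group_nonplanar_desargues:
  fixes c :: "'n::finite six_points"
  assumes n: "CARD('n) > 4" and c: "c \<in> nonplanar_desargues"
  shows "trivial_group (fundamental_group nonplanar_desargues c)"
proof (rule trivial_fundamental_groupI[OF c])
  fix p assume "p \<in> loops nonplanar_desargues c"
  then have p: "path p" "path_image p \<subseteq> nonplanar_desargues" "pathstart p = c" "pathfinish p = c"
    by (auto simp: loops_def)
  let ?F = "{x :: complex ^ 'n ^ 'k. indep_rows UNIV x}"
  obtain x :: "complex ^ 'n ^ 'k" where x: "indep_rows UNIV x" "desargues x = c"
    using c by (rule nonplanar_desarguesE)
  then obtain g where g: "path g" "path_image g \<subseteq> ?F" "pathstart g = x"
    "\<And>t. t \<in> {0..1} \<Longrightarrow> desargues (g t) = p t"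
    using desargues_path_lift[OF p(1,2) x(1)] p(3) by auto
  have "indep_rows UNIV (pathfinish g)" "desargues (pathfinish g) = c"
    using g(2) pathfinish_in_path_image[of g] g(4)[of 1] p(4) by (auto simp: pathfinish_def)
  then obtain \<mu> where \<mu>: "\<mu> \<noteq> 0" "pathfinish g = cscale \<mu> x"
    using x desargues_eq_iff by metis
  obtain w where w: "exp w = \<mu>" using \<mu>(1) by (metis exp_Ln)
  define h where "h t = cscale (exp (of_real t * w)) x" for t :: real
  have h: "path h" "path_image h \<subseteq> ?F" "pathstart h = x" "pathfinish h = cscale \<mu> x"
      "desargues (h t) = c" for t
    using x by (auto simp: h_def path_def path_image_def pathstart_def pathfinish_def w
        indep_rows_cscale desargues_cscale intro!: continuous_intros)
  have "simply_connected ?F"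
    by (rule simply_connected_indep_rows) (use n card_rows in simp)
  then have "homotopic_paths ?F g h"
    using g h \<mu> unfolding simply_connected_eq_homotopic_paths by metis
  then have "homotopic_paths nonplanar_desargues (desargues \<circ> g) (desargues \<circ> h)"
    by (rule homotopic_paths_continuous_image[OF _ continuous_on_desargues])
      (auto simp: desargues_nonplanar)
  moreover have "desargues \<circ> h = (\<lambda>_. c)" using h(5) by auto
  moreover have "homotopic_paths nonplanar_desargues p (desargues \<circ> g)"
    using p g(4) by (intro homotopic_paths_eq) auto
  ultimately show "homotopic_paths nonplanar_desargues p (\<lambda>_. c)"
    using homotopic_paths_trans[of nonplanar_desargues p "desargues \<circ> g"] by simp
qed

section \<open>Ambient dimension three\<close>

lemma fourth_root_of_unity:
  fixes z :: complex
  assumes "z ^ 4 = 1"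
  shows "\<exists>m<4. z = \<i> ^ m"
proof -
  have "(z - 1) * (z + 1) * ((z - \<i>) * (z + \<i>)) = z ^ 4 - 1"
    by (simp add: power4_eq_xxxx algebra_simps)
  then consider "z = 1" | "z = -1" | "z = \<i>" | "z = -\<i>"
    using assms by (auto simp: eq_neg_iff_add_eq_0)
  then show ?thesis
  proof cases
    case 1 then show ?thesis by (intro exI[of _ 0]) simp
  next
    case 2 then show ?thesis by (intro exI[of _ 2]) simp
  next
    case 3 then show ?thesis by (intro exI[of _ 1]) simp
  next
    case 4 then show ?thesis by (intro exI[of _ 3]) (simp add: power3_eq_cube)
  qed
qed

lemma i_power_inject:
  assumes "m < 4" "n < 4" "\<i> ^ m = (\<i> ^ n :: complex)"
  shows "m = n"
proof -
  have "m \<in> {0, 1, 2, 3}" "n \<in> {0, 1, 2, 3}" using assms by auto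
  then show ?thesis using assms(3) by (auto simp: complex_eq_iff power3_eq_cube)
qed

lemma i_power_mod_4: "\<i> ^ (m mod 4) = (\<i> ^ m :: complex)"
proof -
  have "\<i> ^ m = (\<i> ^ (m mod 4 + 4 * (m div 4)) :: complex)" by simp
  also have "\<dots> = \<i> ^ (m mod 4)"
    unfolding power_add power_mult by simp
  finally show ?thesis ..
qed

context four_rows
begin

abbreviation SL :: "(complex ^ 'k ^ 'k) set" where
  "SL \<equiv> {x. det x = 1}"

lemma indep_rows_SL: "x \<in> SL \<Longrightarrow> indep_rows UNIV x"
  by (simp add: indep_rows_iff_det)

lemma SL_desarguesE:
  assumes "d \<in> (nonplanar_desargues :: 'k six_points set)"
  obtains x where "x \<in> SL" "desargues x = d"
proof -
  obtain y :: "complex ^ 'k ^ 'k" where y: "indep_rows UNIV y" "desargues y = d"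
    using assms by (rule nonplanar_desarguesE)
  have nz: "det y \<noteq> 0" using y by (simp add: indep_rows_iff_det)
  define \<mu> where "\<mu> = exp (- Ln (det y) / 4)"
  have "\<mu> ^ 4 = exp (- Ln (det y))" by (simp add: \<mu>_def flip: exp_of_nat_mult)
  then have "\<mu> ^ 4 * det y = 1" using nz by (simp add: exp_minus)
  then have "cscale \<mu> y \<in> SL" by (simp add: det_cscale card_rows)
  moreover have "desargues (cscale \<mu> y) = d" using y by (simp add: desargues_cscale \<mu>_def)
  ultimately show ?thesis using that by blast
qed

text \<open>
  The map induced by \<open>quartic\<close> on configurations. It carries lifting problems for configurations over
  to the covering \<open>quartic\<close> between subsets of normed spaces.
\<close>

definition quartic_of :: "'k six_points \<Rightarrow> complex ^ 'k ^ 'k ^ 'k ^ 'k" where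
  "quartic_of d = quartic (SOME x. x \<in> SL \<and> desargues x = d)"

text \<open>
  Dividing by the determinant makes the degree-four expressions invariant under scaling, which gives
  a formula valid for every invertible representative. Continuity of \<open>quartic_of\<close> follows, although
  its definition uses an arbitrary choice of representative.
\<close>

lemma quartic_of_desargues:
  fixes x :: "complex ^ 'k ^ 'k"
  assumes x: "indep_rows UNIV x"
  shows "quartic_of (desargues x) = (\<chi> i j k l. quartic x $ i $ j $ k $ l / det x)"
proof -
  obtain z where "z \<in> SL" "desargues z = desargues x"
    using SL_desarguesE desargues_nonplanar[OF x] by blast
  then have "\<exists>z. z \<in> SL \<and> desargues z = desargues x" by blast
  from someI_ex[OF this] obtain y where y: "y \<in> SL" "desargues y = desargues x"
    "quartic_of (desargues x) = quartic y"
    unfolding quartic_of_def by blast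
  then obtain \<mu> where \<mu>: "\<mu> \<noteq> 0" "y = cscale \<mu> x"
    using desargues_eq_iff[OF x indep_rows_SL] by metis
  then have "\<mu> ^ 4 * det x = 1" using y(1) by (simp add: det_cscale card_rows)
  then have "\<mu> ^ 4 = 1 / det x" using x by (simp add: indep_rows_iff_det field_simps)
  then show ?thesis unfolding y(3) \<mu>(2) by (simp add: quartic_cscale)
qed

lemma quartic_of_desargues_SL: "x \<in> SL \<Longrightarrow> quartic_of (desargues x) = quartic x"
  using quartic_of_desargues[OF indep_rows_SL, of x] by simp

lemma SL_nonzero: "x \<in> SL \<Longrightarrow> x \<noteq> 0"
  using row_nonzero[OF indep_rows_SL, of x] by auto

lemma inj_on_quartic_of: "inj_on quartic_of nonplanar_desargues"
proof (rule inj_onI)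
  fix d e :: "'k six_points"
  assume d: "d \<in> nonplanar_desargues" and e: "e \<in> nonplanar_desargues"
    and eq: "quartic_of d = quartic_of e"
  obtain x where x: "x \<in> SL" "desargues x = d" using d by (rule SL_desarguesE)
  obtain y where y: "y \<in> SL" "desargues y = e" using e by (rule SL_desarguesE)
  have "quartic x = quartic y"
    using eq x y quartic_of_desargues_SL by metis
  then obtain \<zeta> where "\<zeta> ^ 4 = 1" "y = cscale \<zeta> x"
    using quartic_eq_iff SL_nonzero x(1) by metis
  moreover have "\<zeta> \<noteq> 0" using \<open>\<zeta> ^ 4 = 1\<close> by auto
  ultimately show "d = e" using x y desargues_cscale by metis
qed

lemma continuous_on_quartic_of: "continuous_on nonplanar_desargues quartic_of"
  unfolding continuous_on_topological
proof (intro ballI allI impI)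
  fix d :: "'k six_points" and B
  assume d: "d \<in> nonplanar_desargues" and B: "open B" "quartic_of d \<in> B"
  obtain U and f :: "'k six_points \<Rightarrow> complex ^ 'k ^ 'k" where U: "open U" "d \<in> U"
    and f: "continuous_on (U \<inter> nonplanar_desargues) f"
      "\<And>e. e \<in> U \<inter> nonplanar_desargues \<Longrightarrow> indep_rows UNIV (f e) \<and> desargues (f e) = e"
    using desargues_local_section[of d] by blast
  let ?q = "\<lambda>e. \<chi> i j k l. quartic (f e) $ i $ j $ k $ l / det (f e)"
  have q: "quartic_of e = ?q e" if "e \<in> U \<inter> nonplanar_desargues" for e
    using quartic_of_desargues[of "f e"] f(2)[OF that] by simp
  have "continuous_on (U \<inter> nonplanar_desargues) ?q"
    by (intro continuous_intros continuous_on_quartic continuous_on_det f(1))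
      (use f(2) in \<open>simp add: indep_rows_iff_det\<close>)
  then have "continuous_on (U \<inter> nonplanar_desargues) quartic_of"
    by (rule continuous_on_eq) (use q in simp)
  then obtain A where "open A" "d \<in> A" "\<forall>e\<in>U \<inter> nonplanar_desargues. e \<in> A \<longrightarrow> quartic_of e \<in> B"
    using d U B unfolding continuous_on_topological by (metis IntI)
  then show "\<exists>A. open A \<and> d \<in> A \<and> (\<forall>e\<in>nonplanar_desargues. e \<in> A \<longrightarrow> quartic_of e \<in> B)"
    using U by (intro exI[of _ "A \<inter> U"]) auto
qed

lemma covering_SL: "covering_space SL quartic (quartic ` SL)"
  by (rule covering_space_quartic[OF card_rows])

lemma quartic_of_image: "quartic_of ` nonplanar_desargues \<subseteq> quartic ` SL"
proof safe
  fix d :: "'k six_points" assume "d \<in> nonplanar_desargues"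
  then obtain x where "x \<in> SL" "desargues x = d" by (rule SL_desarguesE)
  then show "quartic_of d \<in> quartic ` SL" using quartic_of_desargues_SL by blast
qed

lemma desargues_SL: "x \<in> SL \<Longrightarrow> desargues x \<in> nonplanar_desargues"
  by (rule desargues_nonplanar[OF indep_rows_SL])

text \<open>
  For each \<open>m\<close> choose a path \<open>\<gamma> m\<close> in \<open>SL\<close> from the base frame \<open>x\<close> to \<open>i\<^sup>m x\<close>. Its image \<open>P m\<close> is a loop whose
  class depends only on \<open>m\<close> modulo \<open>4\<close>, as \<open>SL\<close> is simply connected. Since \<open>i\<^sup>m \<cdot> \<gamma> n\<close> has the same image as
  \<open>\<gamma> n\<close> and continues \<open>\<gamma> m\<close>, the assignment is a homomorphism. Path lifting makes it surjective and
  monodromy makes it injective.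
\<close>

theorem fundamental_group_nonplanar_desargues_iso:
  fixes c :: "'k six_points"
  assumes c: "c \<in> nonplanar_desargues"
  shows "fundamental_group nonplanar_desargues c \<cong> integer_mod_group 4"
proof -
  let ?D = "nonplanar_desargues :: 'k six_points set"
  let ?G = "fundamental_group ?D c"
  obtain x where x: "x \<in> SL" "desargues x = c" using c by (rule SL_desarguesE)
  have SLx: "cscale (\<i> ^ m) y \<in> SL" if "y \<in> SL" for m y
  proof -
    have "(\<i> ^ m) ^ 4 = ((\<i> ^ 4) ^ m :: complex)" by (simp only: power_mult[symmetric] mult.commute)
    then show ?thesis using that by (simp add: det_cscale card_rows)
  qed
  have sc: "path_connected SL" and hp: "\<And>p q. path p \<Longrightarrow> path_image p \<subseteq> SL \<Longrightarrow> path q \<Longrightarrow>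
      path_image q \<subseteq> SL \<Longrightarrow> pathstart q = pathstart p \<Longrightarrow> pathfinish q = pathfinish p \<Longrightarrow> homotopic_paths SL p q"
    using simply_connected_det_1[where 'n = 'k] unfolding simply_connected_eq_homotopic_paths by blast+
  have "\<forall>m. \<exists>g. path g \<and> path_image g \<subseteq> SL \<and> pathstart g = x \<and> pathfinish g = cscale (\<i> ^ m) x"
    using sc SLx[OF x(1)] x(1) unfolding path_connected_def by blast
  then obtain \<gamma> where \<gamma>: "\<And>m. path (\<gamma> m)" "\<And>m. path_image (\<gamma> m) \<subseteq> SL" "\<And>m. pathstart (\<gamma> m) = x"
    "\<And>m. pathfinish (\<gamma> m) = cscale (\<i> ^ m) x"
    by metis
  have cD: "continuous_on SL desargues"
    by (rule continuous_on_subset[OF continuous_on_desargues]) (use indep_rows_SL in blast)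
  have img: "homotopic_paths ?D (desargues \<circ> p) (desargues \<circ> q)" if "homotopic_paths SL p q" for p q
    by (rule homotopic_paths_continuous_image[OF that cD]) (use desargues_SL in blast)
  define P where "P m = desargues \<circ> \<gamma> m" for m
  have end_c: "desargues (cscale (\<i> ^ m) x) = c" for m
    using x by (simp add: desargues_cscale)
  have loop: "desargues \<circ> p \<in> loops ?D c"
    if "path p" "path_image p \<subseteq> SL" "pathstart p = x" "pathfinish p = cscale (\<i> ^ m) x" for p m
    using that desargues_SL x(2) end_c[of m]
    unfolding loops_def mem_Collect_eq path_image_compose pathstart_compose pathfinish_compose
    by (intro conjI path_continuous_image continuous_on_subset[OF cD]) auto
  have P: "P m \<in> loops ?D c" for m
    unfolding P_def using \<gamma> by (intro loop[of _ m]) auto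
  have hom_P: "homotopic_paths ?D (desargues \<circ> p) (P m)"
    if "path p" "path_image p \<subseteq> SL" "pathstart p = x" "pathfinish p = cscale (\<i> ^ m) x" for p m
    unfolding P_def by (intro img hp) (use that \<gamma> in simp_all)
  have P_add: "homotopic_paths ?D (P m +++ P n) (P ((m + n) mod 4))" for m n
  proof -
    let ?h = "\<gamma> m +++ (cscale (\<i> ^ m) \<circ> \<gamma> n)"
    have cs: "path (cscale (\<i> ^ m) \<circ> \<gamma> n)" "path_image (cscale (\<i> ^ m) \<circ> \<gamma> n) \<subseteq> SL"
      "pathstart (cscale (\<i> ^ m) \<circ> \<gamma> n) = cscale (\<i> ^ m) x"
      "pathfinish (cscale (\<i> ^ m) \<circ> \<gamma> n) = cscale (\<i> ^ (m + n)) x"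
    proof -
      show "path (cscale (\<i> ^ m) \<circ> \<gamma> n)"
        by (intro path_continuous_image \<gamma> continuous_intros)
      show "path_image (cscale (\<i> ^ m) \<circ> \<gamma> n) \<subseteq> SL"
        unfolding path_image_compose using \<gamma>(2) SLx by blast
      show "pathstart (cscale (\<i> ^ m) \<circ> \<gamma> n) = cscale (\<i> ^ m) x"
        "pathfinish (cscale (\<i> ^ m) \<circ> \<gamma> n) = cscale (\<i> ^ (m + n)) x"
        by (simp_all add: pathstart_compose pathfinish_compose \<gamma> power_add)
    qed
    have "desargues \<circ> ?h = P m +++ P n"
      by (auto simp: P_def path_compose_join fun_eq_iff joinpaths_def desargues_cscale)
    moreover have "homotopic_paths ?D (desargues \<circ> ?h) (P ((m + n) mod 4))"
    proof (rule hom_P)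
      show "path ?h" "pathstart ?h = x"
        using \<gamma> cs by auto
      show "path_image ?h \<subseteq> SL"
        by (rule subset_path_image_join[OF \<gamma>(2) cs(2)])
      show "pathfinish ?h = cscale (\<i> ^ ((m + n) mod 4)) x"
        using cs by (simp add: i_power_mod_4)
    qed
    ultimately show ?thesis by simp
  qed
  have surj: "\<exists>m<4. homotopic_paths ?D p (P m)" if p: "p \<in> loops ?D c" for p
  proof -
    have p': "path p" "path_image p \<subseteq> ?D" "pathstart p = c" "pathfinish p = c"
      using p by (auto simp: loops_def)
    have "path (quartic_of \<circ> p)"
      by (intro path_continuous_image p' continuous_on_subset[OF continuous_on_quartic_of])
    moreover have "path_image (quartic_of \<circ> p) \<subseteq> quartic ` SL"
      using p'(2) quartic_of_image unfolding path_image_compose by blast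
    moreover have "pathstart (quartic_of \<circ> p) = quartic x"
      using p'(3) x(2) quartic_of_desargues_SL[OF x(1)] by (simp add: pathstart_compose)
    ultimately obtain g where g: "path g" "path_image g \<subseteq> SL" "pathstart g = x"
      "\<And>t. t \<in> {0..1} \<Longrightarrow> quartic (g t) = (quartic_of \<circ> p) t"
      using covering_space_lift_path_strong[OF covering_SL x(1)] by blast
    have gp: "desargues (g t) = p t" if t: "t \<in> {0..1}" for t
    proof -
      have "g t \<in> path_image g" using t by (simp add: path_image_def)
      then have "g t \<in> SL" using g(2) by blast
      moreover have "p t \<in> ?D" using p'(2) t by (auto simp: path_image_def)
      moreover have "quartic_of (desargues (g t)) = quartic_of (p t)"
        using g(4)[OF t] quartic_of_desargues_SL[OF \<open>g t \<in> SL\<close>] by simp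
      ultimately show ?thesis using inj_on_quartic_of desargues_SL by (metis inj_onD)
    qed
    have fin: "pathfinish g \<in> SL" using g(2) by auto
    have "desargues x = desargues (pathfinish g)"
      using gp[of 1] p'(4) x by (simp add: pathfinish_def)
    then obtain \<mu> where \<mu>: "pathfinish g = cscale \<mu> x"
      using desargues_eq_iff[OF indep_rows_SL[OF x(1)] indep_rows_SL[OF fin]] by blast
    then have "\<mu> ^ 4 = 1" using fin x(1) by (simp add: det_cscale card_rows)
    then obtain m where m: "m < 4" "\<mu> = \<i> ^ m" using fourth_root_of_unity by blast
    have "homotopic_paths ?D p (desargues \<circ> g)"
      using p' gp by (intro homotopic_paths_eq) auto
    moreover have "homotopic_paths ?D (desargues \<circ> g) (P m)"
      using g \<mu> m by (intro hom_P) auto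
    ultimately show ?thesis using m homotopic_paths_trans by blast
  qed
  have inj: "m = n" if mn: "m < 4" "n < 4" and hom: "homotopic_paths ?D (P m) (P n)" for m n
  proof -
    have hq: "homotopic_paths (quartic ` SL) (quartic_of \<circ> P m) (quartic_of \<circ> P n)"
      by (rule homotopic_paths_continuous_image[OF hom continuous_on_quartic_of])
        (use quartic_of_image in blast)
    have lift: "quartic (\<gamma> k t) = (quartic_of \<circ> P k) t" if "t \<in> {0..1}" for k t
    proof -
      have "\<gamma> k t \<in> SL" using \<gamma>(2) that unfolding path_image_def by blast
      then show ?thesis unfolding P_def comp_apply by (rule quartic_of_desargues_SL[symmetric])
    qed
    note pth = homotopic_paths_imp_path[OF hq] and sub = homotopic_paths_imp_subset[OF hq]
    have "pathfinish (\<gamma> m) = pathfinish (\<gamma> n)"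
      by (rule covering_space_monodromy[OF covering_SL pth[THEN conjunct1] sub[THEN conjunct1]
            pth[THEN conjunct2] sub[THEN conjunct2] hq \<gamma>(1,2) lift \<gamma>(1,2) lift])
        (simp_all add: \<gamma>)
    then have e: "cscale (\<i> ^ m) x = cscale (\<i> ^ n) x" by (simp add: \<gamma>)
    then have "\<i> ^ m *s x $ k1 = \<i> ^ n *s x $ k1" by (metis cscale_nth)
    then have "\<i> ^ m = (\<i> ^ n :: complex)"
      using row_nonzero(1)[OF indep_rows_SL[OF x(1)]] by simp
    then show ?thesis using mn i_power_inject by blast
  qed
  let ?\<phi> = "\<lambda>k. loop_class ?D (P (nat k))"
  have "?\<phi> \<in> iso (integer_mod_group 4) ?G"
  proof (rule isoI)
    show "?\<phi> \<in> hom (integer_mod_group 4) ?G"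
    proof (rule homI)
      show "?\<phi> k \<in> carrier ?G" for k using P by (simp add: fundamental_group_def)
      fix k l assume kl: "k \<in> carrier (integer_mod_group 4)" "l \<in> carrier (integer_mod_group 4)"
      then have "0 \<le> k" "0 \<le> l" by (auto simp: carrier_integer_mod_group)
      then have "nat ((k + l) mod 4) = (nat k + nat l) mod 4"
        by (simp add: nat_mod_distrib nat_add_distrib)
      then show "?\<phi> (k \<otimes>\<^bsub>integer_mod_group 4\<^esub> l) = ?\<phi> k \<otimes>\<^bsub>?G\<^esub> ?\<phi> l"
        using loop_class_cong[OF P_add[of "nat k" "nat l"]]
        by (simp add: mult_loop_class[OF P P])
    qed
    show "bij_betw ?\<phi> (carrier (integer_mod_group 4)) (carrier ?G)"
      unfolding bij_betw_def
    proof
      show "inj_on ?\<phi> (carrier (integer_mod_group 4))"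
      proof (rule inj_onI)
        fix k l assume kl: "k \<in> carrier (integer_mod_group 4)" "l \<in> carrier (integer_mod_group 4)"
          and eq: "?\<phi> k = ?\<phi> l"
        have "P (nat l) \<in> loop_class ?D (P (nat l))"
          using P[of "nat l"] by (simp add: loop_class_def loops_def)
        then have "P (nat l) \<in> loop_class ?D (P (nat k))" using eq by simp
        then have "homotopic_paths ?D (P (nat k)) (P (nat l))" by (simp add: loop_class_def)
        then have "nat k = nat l"
          using kl by (intro inj) (auto simp: carrier_integer_mod_group)
        then show "k = l" using kl by (auto simp: carrier_integer_mod_group)
      qed
      show "?\<phi> ` carrier (integer_mod_group 4) = carrier ?G"
      proof (intro antisym subsetI)
        fix Q assume "Q \<in> carrier ?G"
        then obtain p where p: "p \<in> loops ?D c" "Q = loop_class ?D p"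
          by (auto simp: fundamental_group_def)
        obtain m where m: "m < 4" "homotopic_paths ?D p (P m)" using surj[OF p(1)] by blast
        have "Q = ?\<phi> (int m)" using loop_class_cong[OF m(2)] p(2) by simp
        moreover have "int m \<in> carrier (integer_mod_group 4)"
          using m(1) by (simp add: carrier_integer_mod_group)
        ultimately show "Q \<in> ?\<phi> ` carrier (integer_mod_group 4)" by blast
      qed (use P in \<open>auto simp: fundamental_group_def\<close>)
    qed
  qed
  then have "integer_mod_group 4 \<cong> ?G" by (auto simp: is_iso_def)
  then show ?thesis by (simp add: group.iso_sym)
qed

end

section \<open>The fundamental group of the configuration space\<close>

theorem theorem1p5:
  fixes n :: nat and c :: "'n::finite six_points"
  assumes "n \<ge> 3" and "CARD('n) = n + 1"
    and "c \<in> nonplanar_desargues"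
  shows "(n = 3 \<longrightarrow> fundamental_group nonplanar_desargues c \<cong> integer_mod_group 4) \<and>
         (n \<ge> 4 \<longrightarrow> trivial_group (fundamental_group nonplanar_desargues c))"
proof (intro conjI impI)
  assume "n = 3"
  then have "CARD('n) = 4" using assms(2) by simp
  then obtain xs :: "'n list" where xs: "distinct xs" "set xs = UNIV" "length xs = 4"
    by (metis distinct_card finite finite_distinct_list)
  then obtain k0 k1 k2 k3 where "xs = [k0, k1, k2, k3]"
    by (auto simp: length_Suc_conv numeral_eq_Suc)
  then interpret four_rows k0 k1 k2 k3
    using xs by unfold_locales auto
  show "fundamental_group nonplanar_desargues c \<cong> integer_mod_group 4"
    by (rule fundamental_group_nonplanar_desargues_iso[OF assms(3)])
next
  assume "n \<ge> 4"
  have all: "set [1, 2, 3, 4 :: 4] = UNIV" by (simp only: list.set UNIV_4)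
  interpret four_rows "1 :: 4" 2 3 4
  proof
    show "distinct [1, 2, 3, 4 :: 4]" by (rule card_distinct) (simp only: all, simp)
    show "UNIV = {1, 2, 3, 4 :: 4}" by (rule UNIV_4)
  qed
  show "trivial_group (fundamental_group nonplanar_desargues c)"
    by (rule trivial_fundamental_group_nonplanar_desargues) (use assms \<open>n \<ge> 4\<close> in auto)
qed

end
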